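(* Let $V=\{1,\dots,n\}$ and $\mathcal{H}=\bigotimes_{v\in V}\mathcal{H}^v$ with $\dim\mathcal{H}^v=d$. Let $k\ge 1$ and $g>0$. Let $H=\sum_{X\subseteq V,\,|X|\le k} h_X$, where each $h_X$ is a Hermitian operator on $\mathcal{H}$ supported on $X$, with $\sum_{X:X\ni v}\|h_X\|\le g$ for all $v\in V$. Let $\mathcal{F}=\sum_{X\subseteq V,\,|X|\le k} f_X$, where each $f_X$ is a Hermitian operator supported on $X$, with $\sum_{X:X\ni v}\|f_X\|\le g$ for all $v\in V$, and set $\bar{\mathcal{F}}:=\sum_{|X|\le k}\|f_X\|$. Let $\beta\ge 0$, $\rho=e^{-\beta H}/Z$ with $Z=\mathrm{tr}(e^{-\beta H})$, and $\langle\mathcal{F}\rangle_\beta:=\mathrm{tr}(\mathcal{F}\rho)$. If $$\beta<\beta_c:=\frac{1}{8e^3gk},$$ then for every real $\tau$ with $|\tau|<\beta_c-\beta$, $$\log\big[\mathrm{tr}(e^{-\tau\mathcal{F}}\rho)\big]\le -\tau\langle\mathcal{F}\rangle_\beta+\frac{\tau^2\bar{\mathcal{F}}}{\beta_c-\beta-|\tau|}.$$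
   Context: $\|\cdot\|$ is the operator norm. An operator "supported on $X$" acts as the identity on $\bigotimes_{v\notin X}\mathcal{H}^v$. The sums $\sum_{X:X\ni v}$ run over all subsets $X\subseteq V$ with $|X|\le k$ containing $v$. *)

theory Defs
  imports "HOL-Analysis.Analysis"
begin

text \<open>Spin system on sites V = UNIV :: 'v set (n = CARD('v)), each site carrying a
 d-dimensional Hilbert space with d = CARD('q). The total Hilbert space is
 spanned by the configurations 'v \<Rightarrow> 'q; operators are square complex matrices
 indexed by configurations.\<close>

type_synonym ('v, 'q) op = "complex ^ ('v \<Rightarrow> 'q) ^ ('v \<Rightarrow> 'q)"

primrec mat_pow :: "'a::semiring_1 ^ 'n ^ 'n \<Rightarrow> nat \<Rightarrow> 'a ^ 'n ^ 'n" where
  "mat_pow A 0 = mat 1"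
| "mat_pow A (Suc m) = A ** mat_pow A m"

definition mat_exp :: "complex ^ 'n ^ 'n \<Rightarrow> complex ^ 'n ^ 'n" where
  "mat_exp A = (\<Sum>m. (1 / fact m) *\<^sub>R mat_pow A m)"

definition op_norm :: "complex ^ 'n ^ 'n \<Rightarrow> real" where
  "op_norm A = onorm (\<lambda>x. A *v x)"

definition hermitian :: "complex ^ 'n ^ 'n \<Rightarrow> bool" where
  "hermitian A \<longleftrightarrow> (\<forall>i j. A $ i $ j = cnj (A $ j $ i))"

text \<open>An operator is supported on X iff it is of the form a_X \<otimes> identity on the
 complement of X: its matrix entries vanish unless the two configurations agree
 off X, and otherwise depend only on the restrictions of the configurations to X.\<close>
definition supported_on :: "'v::finite set \<Rightarrow> ('v, 'q::finite) op \<Rightarrow> bool" where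
  "supported_on X A \<longleftrightarrow>
     (\<exists>a :: ('v \<Rightarrow> 'q) \<Rightarrow> ('v \<Rightarrow> 'q) \<Rightarrow> complex.
        (\<forall>s t s' t'. (\<forall>v\<in>X. s v = s' v \<and> t v = t' v) \<longrightarrow> a s t = a s' t') \<and>
        (\<forall>s t. A $ s $ t = (if (\<forall>v. v \<notin> X \<longrightarrow> s v = t v) then a s t else 0)))"

end

theory Submission
  imports Defs "HOL-Complex_Analysis.Cauchy_Integral_Formula"
begin

text \<open>
  For complex \<open>z\<close> put \<open>Z(z) = tr (exp (- z F) exp (- \<beta> H))\<close> and \<open>R = \<beta>\<^sub>c - \<beta>\<close>. The point is the
  locality estimate \<open>|tr (A exp (- z F) exp (- \<beta> H))| \<le> 2 \<parallel>A\<parallel> |Z(z)|\<close> for \<open>|z| \<le> R\<close> and every \<open>A\<close>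
  supported on at most \<open>k\<close> sites. Summing it over the terms of \<open>F\<close> gives \<open>|Z'| \<le> 2 Fbar |Z|\<close> and
  \<open>Z \<noteq> 0\<close> on the disc, so Cauchy's inequality bounds \<open>(log Z)''\<close> at \<open>s\<close> by \<open>2 Fbar / (R - |s|)\<close>, and
  the second-order Taylor formula for \<open>log Z\<close> is the claim.

  To prove the locality estimate, approximate the two exponentials by ordered products of factors
  \<open>1 + a\<^sub>i\<close>, where \<open>a\<^sub>i\<close> is a small multiple of a single interaction term, supported on \<open>Y\<^sub>i\<close>.
  Expand, one at a time, the factors whose support meets the support \<open>S\<close> of the observable: choosing
  \<open>1\<close> deletes the factor, choosing \<open>a\<^sub>i\<close> costs \<open>\<parallel>a\<^sub>i\<parallel>\<close> and enlarges \<open>S\<close> to \<open>S \<union> Y\<^sub>i\<close>. Once no factor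
  meets \<open>S\<close>, the normalised trace factorises. The same expansion bounds the change of \<open>Z\<close> itself when
  a factor is deleted, so the number of active factors serves as the induction parameter and no
  cluster sums occur.
\<close>

subsection \<open>The Banach algebra of complex matrices\<close>

lemma norm_matrix_vector_le_op_norm: "norm (A *v x) \<le> op_norm A * norm x"
  for A :: "complex ^ 'n ^ 'n"
  unfolding op_norm_def by (rule onorm) simp

lemma op_norm_le:
  fixes A :: "complex ^ 'n ^ 'n"
  assumes "\<And>x. norm (A *v x) \<le> B * norm x"
  shows "op_norm A \<le> B"
  unfolding op_norm_def using assms by (rule onorm_le)

lemma op_norm_nonneg: "0 \<le> op_norm A" for A :: "complex ^ 'n ^ 'n"
  unfolding op_norm_def by (rule onorm_pos_le) simp

lemma norm_entry_le_op_norm: "norm (A $ i $ j) \<le> op_norm A" for A :: "complex ^ 'n ^ 'n"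
proof -
  have "norm (A $ i $ j) = norm ((A *v axis j 1) $ i)"
    by (simp add: axis_def matrix_vector_mult_def if_distrib cong: if_cong)
  also have "\<dots> \<le> norm (A *v axis j 1)"
    by (rule Finite_Cartesian_Product.norm_nth_le)
  also have "\<dots> \<le> op_norm A"
    using norm_matrix_vector_le_op_norm[of A "axis j 1"] by (simp add: norm_axis_1)
  finally show ?thesis .
qed

text \<open>Together with the bound of each entry by the operator norm, this reduces convergence and
  completeness to the entries.\<close>

lemma op_norm_le_sum_entries: "op_norm A \<le> (\<Sum>i\<in>UNIV. \<Sum>j\<in>UNIV. norm (A $ i $ j))"
  for A :: "complex ^ 'n ^ 'n"
proof (rule op_norm_le)
  fix x :: "complex ^ 'n"
  have "norm (A *v x) \<le> (\<Sum>i\<in>UNIV. norm ((A *v x) $ i))"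
    unfolding norm_vec_def by (rule L2_set_le_sum) simp
  also have "\<dots> \<le> (\<Sum>i\<in>UNIV. \<Sum>j\<in>UNIV. norm (A $ i $ j) * norm x)"
    by (intro sum_mono) (auto simp: matrix_vector_mult_def norm_mult
        intro!: order_trans[OF norm_sum] sum_mono mult_left_mono Finite_Cartesian_Product.norm_nth_le)
  also have "\<dots> = (\<Sum>i\<in>UNIV. \<Sum>j\<in>UNIV. norm (A $ i $ j)) * norm x"
    by (simp add: sum_distrib_right)
  finally show "norm (A *v x) \<le> (\<Sum>i\<in>UNIV. \<Sum>j\<in>UNIV. norm (A $ i $ j)) * norm x" .
qed

lemma mat_vector_mult: "mat c *v x = c *s x" for x :: "complex ^ 'n"
  by (simp add: vec_eq_iff mat_def matrix_vector_mult_def if_distrib if_distribR cong: if_cong)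

lemma op_norm_mat: "op_norm (mat c :: complex ^ 'n ^ 'n) = norm c"
proof (rule antisym)
  have "norm (c *s x) = norm c * norm x" for x :: "complex ^ 'n"
    by (simp add: norm_vec_def norm_mult L2_set_right_distrib)
  then show "op_norm (mat c :: complex ^ 'n ^ 'n) \<le> norm c"
    by (intro op_norm_le) (simp add: mat_vector_mult)
  show "norm c \<le> op_norm (mat c :: complex ^ 'n ^ 'n)"
    using norm_entry_le_op_norm[of "mat c :: complex ^ 'n ^ 'n" undefined undefined]
    by (simp add: mat_def)
qed

text \<open>A copy of the matrix type: \<open>vec\<close> already carries the Euclidean norm, and \<open>exp\<close> needs the
  operator norm and the matrix product.\<close>
typedef 'n cmat = "UNIV :: (complex ^ ('n::finite) ^ 'n) set"
  morphisms matrix_of Cmat ..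

setup_lifting type_definition_cmat

instantiation cmat :: (finite) real_algebra_1
begin

lift_definition zero_cmat :: "'a cmat" is 0 .
lift_definition one_cmat :: "'a cmat" is "mat 1" .
lift_definition plus_cmat :: "'a cmat \<Rightarrow> 'a cmat \<Rightarrow> 'a cmat" is "(+)" .
lift_definition minus_cmat :: "'a cmat \<Rightarrow> 'a cmat \<Rightarrow> 'a cmat" is "(-)" .
lift_definition uminus_cmat :: "'a cmat \<Rightarrow> 'a cmat" is uminus .
lift_definition times_cmat :: "'a cmat \<Rightarrow> 'a cmat \<Rightarrow> 'a cmat" is "(**)" .
lift_definition scaleR_cmat :: "real \<Rightarrow> 'a cmat \<Rightarrow> 'a cmat" is "(*\<^sub>R)" .

instance
proof
  fix a b c :: "'a cmat" and r s :: real
  show "a + b + c = a + (b + c)" by transfer (simp add: add.assoc)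
  show "a + b = b + a" by transfer (simp add: add.commute)
  show "0 + a = a" by transfer simp
  show "- a + a = 0" by transfer simp
  show "a - b = a + - b" by transfer simp
  show "r *\<^sub>R (a + b) = r *\<^sub>R a + r *\<^sub>R b" by transfer (simp add: scaleR_right_distrib)
  show "(r + s) *\<^sub>R a = r *\<^sub>R a + s *\<^sub>R a" by transfer (simp add: scaleR_left_distrib)
  show "r *\<^sub>R s *\<^sub>R a = (r * s) *\<^sub>R a" by transfer simp
  show "1 *\<^sub>R a = a" by transfer simp
  show "a * b * c = a * (b * c)" by transfer (simp add: matrix_mul_assoc)
  show "(a + b) * c = a * c + b * c"
    by transfer (simp add: matrix_matrix_mult_def vec_eq_iff distrib_right sum.distrib)
  show "a * (b + c) = a * b + a * c" by transfer (simp add: matrix_add_ldistrib)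
  show "r *\<^sub>R a * b = r *\<^sub>R (a * b)"
    by transfer (simp add: matrix_matrix_mult_def vec_eq_iff scaleR_sum_right)
  show "a * r *\<^sub>R b = r *\<^sub>R (a * b)"
    by transfer (simp add: matrix_matrix_mult_def vec_eq_iff scaleR_sum_right)
  show "1 * a = a" by transfer simp
  show "a * 1 = a" by transfer simp
  show "(0::'a cmat) \<noteq> 1" by transfer (auto simp: vec_eq_iff mat_def)
qed

end

instantiation cmat :: (finite) real_normed_algebra_1
begin

lift_definition norm_cmat :: "'a cmat \<Rightarrow> real" is op_norm .

definition dist_cmat :: "'a cmat \<Rightarrow> 'a cmat \<Rightarrow> real"
  where "dist_cmat a b = norm (a - b)"
definition uniformity_cmat :: "('a cmat \<times> 'a cmat) filter"
  where "uniformity_cmat = (INF e\<in>{0 <..}. principal {(x, y). dist x y < e})"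
definition open_cmat :: "'a cmat set \<Rightarrow> bool"
  where "open_cmat U \<longleftrightarrow> (\<forall>x\<in>U. \<forall>\<^sub>F (x', y) in uniformity. x' = x \<longrightarrow> y \<in> U)"
definition sgn_cmat :: "'a cmat \<Rightarrow> 'a cmat"
  where "sgn_cmat a = a /\<^sub>R norm a"

instance
proof
  fix a b :: "'a cmat" and r :: real
  show "dist a b = norm (a - b)" by (rule dist_cmat_def)
  show "sgn a = a /\<^sub>R norm a" by (rule sgn_cmat_def)
  show "(uniformity :: ('a cmat \<times> 'a cmat) filter)
      = (INF e\<in>{0 <..}. principal {(x, y). dist x y < e})"
    by (rule uniformity_cmat_def)
  show "open U \<longleftrightarrow> (\<forall>x\<in>U. \<forall>\<^sub>F (x', y) in uniformity. x' = x \<longrightarrow> y \<in> U)"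
    for U :: "'a cmat set"
    by (rule open_cmat_def)
  show "norm a = 0 \<longleftrightarrow> a = 0"
  proof transfer
    fix A :: "complex ^ 'a ^ 'a"
    show "op_norm A = 0 \<longleftrightarrow> A = 0"
    proof
      assume "op_norm A = 0"
      then have "norm (A $ i $ j) \<le> 0" for i j
        using norm_entry_le_op_norm[of A i j] by simp
      then show "A = 0" by (simp add: vec_eq_iff)
    next
      assume "A = 0"
      then show "op_norm A = 0" 
        using op_norm_mat[of 0, where 'n='a] by simp
    qed
  qed
  show "norm (a + b) \<le> norm a + norm b"
  proof transfer
    fix A B :: "complex ^ 'a ^ 'a"
    show "op_norm (A + B) \<le> op_norm A + op_norm B"
      unfolding op_norm_def matrix_vector_mult_add_rdistrib by (rule onorm_triangle) simp_all
  qed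
  show "norm (r *\<^sub>R a) = \<bar>r\<bar> * norm a"
  proof transfer
    fix r and A :: "complex ^ 'a ^ 'a"
    have "(*v) (r *\<^sub>R A) = (\<lambda>x. r *\<^sub>R (A *v x))"
      by (auto simp: matrix_vector_mult_def vec_eq_iff scaleR_sum_right)
    then show "op_norm (r *\<^sub>R A) = \<bar>r\<bar> * op_norm A"
      by (simp add: op_norm_def onorm_scaleR)
  qed
  show "norm (a * b) \<le> norm a * norm b"
  proof transfer
    fix A B :: "complex ^ 'a ^ 'a"
    have "norm (A *v (B *v x)) \<le> op_norm A * (op_norm B * norm x)" for x
      by (rule order_trans[OF norm_matrix_vector_le_op_norm])
        (intro mult_left_mono norm_matrix_vector_le_op_norm op_norm_nonneg)
    then show "op_norm (A ** B) \<le> op_norm A * op_norm B"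
      by (intro op_norm_le) (simp add: matrix_vector_mul_assoc[symmetric] mult.assoc)
  qed
  show "norm (1 :: 'a cmat) = 1" by transfer (simp add: op_norm_mat)
qed

end

section \<open>Entries, exponential, complex scalars and the normalised trace\<close>

definition entry :: "'n::finite \<Rightarrow> 'n \<Rightarrow> 'n cmat \<Rightarrow> complex"
  where "entry i j a = matrix_of a $ i $ j"

lemma cmat_eqI: "(\<And>i j. entry i j a = entry i j b) \<Longrightarrow> a = b"
  by (simp add: entry_def vec_eq_iff flip: matrix_of_inject)

lemma bounded_linear_entry: "bounded_linear (entry i j)"
proof (rule bounded_linear_intro[where K = 1])
  show "entry i j (a + b) = entry i j a + entry i j b" for a b
    by (simp add: entry_def plus_cmat.rep_eq)
  show "entry i j (r *\<^sub>R a) = r *\<^sub>R entry i j a" for r a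
    by (simp add: entry_def scaleR_cmat.rep_eq)
  show "norm (entry i j a) \<le> norm a * 1" for a
    by (simp add: entry_def norm_cmat.rep_eq norm_entry_le_op_norm)
qed

lemma norm_le_sum_entries: "norm a \<le> (\<Sum>i\<in>UNIV. \<Sum>j\<in>UNIV. norm (entry i j a))"
  by (simp add: entry_def norm_cmat.rep_eq op_norm_le_sum_entries)

lemma tendsto_cmatI:
  assumes "\<And>i j. ((\<lambda>x. entry i j (f x)) \<longlongrightarrow> entry i j l) F"
  shows "(f \<longlongrightarrow> l) F"
proof (rule Lim_null[THEN iffD2], rule Lim_null_comparison)
  interpret bounded_linear "entry i j" for i j :: 'a by (rule bounded_linear_entry)
  show "\<forall>\<^sub>F x in F. norm (f x - l) \<le> (\<Sum>i\<in>UNIV. \<Sum>j\<in>UNIV. norm (entry i j (f x) - entry i j l))"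
    using norm_le_sum_entries by (auto simp flip: diff intro!: always_eventually)
  show "((\<lambda>x. \<Sum>i\<in>UNIV. \<Sum>j\<in>UNIV. norm (entry i j (f x) - entry i j l)) \<longlongrightarrow> 0) F"
    using assms by (intro tendsto_null_sum tendsto_norm_zero LIM_zero)
qed

instance cmat :: (finite) banach
proof
  fix f :: "nat \<Rightarrow> 'a cmat"
  assume "Cauchy f"
  then have "convergent (\<lambda>n. entry i j (f n))" for i j
    by (intro Cauchy_convergent bounded_linear.Cauchy[OF bounded_linear_entry])
  then obtain l where l: "\<And>i j. (\<lambda>n. entry i j (f n)) \<longlonglongrightarrow> l i j"
    unfolding convergent_def by metis
  have "f \<longlonglongrightarrow> Cmat (\<chi> i j. l i j)"
    by (rule tendsto_cmatI) (simp add: entry_def Cmat_inverse l[unfolded entry_def])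
  then show "convergent f" by (rule convergentI)
qed

lemma matrix_of_power: "matrix_of (a ^ m) = mat_pow (matrix_of a) m"
  by (induction m) (simp_all add: one_cmat.rep_eq times_cmat.rep_eq)

lemma matrix_of_exp: "matrix_of (exp a) = mat_exp (matrix_of a)"
proof -
  have "(\<lambda>m. (1 / fact m) *\<^sub>R mat_pow (matrix_of a) m) sums matrix_of (exp a)"
    unfolding sums_def
  proof (intro vec_tendstoI)
    fix i j
    have "(\<lambda>m. entry i j (a ^ m /\<^sub>R fact m)) sums entry i j (exp a)"
      by (rule bounded_linear.sums[OF bounded_linear_entry exp_converges])
    then show "(\<lambda>n. (\<Sum>m<n. (1 / fact m) *\<^sub>R mat_pow (matrix_of a) m) $ i $ j)
        \<longlonglongrightarrow> matrix_of (exp a) $ i $ j"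
      by (simp add: sums_def entry_def matrix_of_power scaleR_cmat.rep_eq inverse_eq_divide)
  qed
  then show ?thesis
    unfolding mat_exp_def by (rule sums_unique)
qed

lemma matrix_of_sum: "matrix_of (\<Sum>x\<in>S. a x) = (\<Sum>x\<in>S. matrix_of (a x))"
  by (induction S rule: infinite_finite_induct) (simp_all add: zero_cmat.rep_eq plus_cmat.rep_eq)

lemma entry_mult: "entry i j (a * b) = (\<Sum>l\<in>UNIV. entry i l a * entry l j b)"
  by (simp add: entry_def times_cmat.rep_eq matrix_matrix_mult_def)

lemma entry_one: "entry i j 1 = (if i = j then 1 else 0)"
  by (simp add: entry_def one_cmat.rep_eq mat_def)

lemma entry_add: "entry i j (a + b) = entry i j a + entry i j b"
  by (simp add: entry_def plus_cmat.rep_eq)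

lemma entry_scaleR: "entry i j (r *\<^sub>R a) = of_real r * entry i j a"
  by (simp add: entry_def scaleR_cmat.rep_eq scaleR_conv_of_real[where 'a=complex])

lemma entry_sum: "entry i j (\<Sum>x\<in>S. a x) = (\<Sum>x\<in>S. entry i j (a x))"
  by (rule linear_sum[OF bounded_linear.linear[OF bounded_linear_entry]])

text \<open>\<open>cmat\<close> is only a real algebra, so a complex scalar acts through the
  corresponding scalar matrix. The complex parameter of the partition function enters this
  way.\<close>

definition cscale :: "complex \<Rightarrow> 'n::finite cmat \<Rightarrow> 'n cmat"
  where "cscale z a = Cmat (mat z) * a"

lemma entry_cscale: "entry i j (cscale z a) = z * entry i j a"
  unfolding cscale_def entry_mult
  by (simp add: entry_def Cmat_inverse mat_def if_distrib if_distribR cong: if_cong)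

lemma cscale_of_real: "cscale (of_real r) a = r *\<^sub>R a"
  by (rule cmat_eqI) (simp add: entry_cscale entry_scaleR)

lemma cscale_zero: "cscale 0 a = 0" for a :: "'n::finite cmat"
  using cscale_of_real[of 0 a] by simp

lemma cscale_mult: "cscale z a * cscale w b = cscale (z * w) (a * b)"
  by (rule cmat_eqI) (simp add: entry_cscale entry_mult sum_distrib_left mult_ac)

lemma cscale_power: "cscale z a ^ m = cscale (z ^ m) (a ^ m)"
proof (induction m)
  case 0
  show ?case using cscale_of_real[of 1 1] by simp
qed (simp add: cscale_mult)

lemma norm_cscale_le: "norm (cscale z a) \<le> norm z * norm a"
  unfolding cscale_def using norm_mult_ineq[of "Cmat (mat z)" a]
  by (simp add: norm_cmat.rep_eq Cmat_inverse op_norm_mat)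

text \<open>Dividing by the dimension gives the identity the value 1, bounds the functional by the
  operator norm and makes it multiplicative on disjoint supports.\<close>

definition ntrace :: "'n::finite cmat \<Rightarrow> complex"
  where "ntrace a = trace (matrix_of a) / of_nat CARD('n)"

lemma ntrace_conv_entry: "ntrace a = (\<Sum>i\<in>UNIV. entry i i a) / of_nat CARD('n)"
  for a :: "'n::finite cmat"
  by (simp add: ntrace_def trace_def entry_def)

lemma trace_matrix_of: "trace (matrix_of a) = of_nat CARD('n) * ntrace a" for a :: "'n::finite cmat"
  by (simp add: ntrace_def)

lemma ntrace_cscale: "ntrace (cscale z a) = z * ntrace a"
  by (simp add: ntrace_conv_entry entry_cscale sum_distrib_left)

lemma ntrace_one: "ntrace 1 = 1"
  by (simp add: ntrace_conv_entry entry_one)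

lemma norm_ntrace_le: "norm (ntrace a) \<le> norm a" for a :: "'n::finite cmat"
proof -
  have "norm (\<Sum>i\<in>(UNIV::'n set). entry i i a) \<le> of_nat CARD('n) * norm a"
    by (intro sum_norm_bound) (simp add: entry_def norm_cmat.rep_eq norm_entry_le_op_norm)
  then show ?thesis
    by (simp add: ntrace_conv_entry norm_divide field_simps)
qed

lemma bounded_linear_ntrace: "bounded_linear ntrace"
proof (rule bounded_linear_intro[where K = 1])
  show "ntrace (a + b) = ntrace a + ntrace b" for a b :: "'n::finite cmat"
    by (simp add: ntrace_conv_entry entry_add sum.distrib add_divide_distrib)
  show "ntrace (r *\<^sub>R a) = r *\<^sub>R ntrace a" for r and a :: "'n::finite cmat"
    using ntrace_cscale[of "of_real r" a] by (simp add: cscale_of_real scaleR_conv_of_real)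
qed (simp add: norm_ntrace_le)

section \<open>Hermitian matrices\<close>

definition hermitian_cmat :: "'n::finite cmat \<Rightarrow> bool"
  where "hermitian_cmat a \<longleftrightarrow> hermitian (matrix_of a)"

lemma hermitian_cmat_iff: "hermitian_cmat a \<longleftrightarrow> (\<forall>i j. cnj (entry i j a) = entry j i a)"
  unfolding hermitian_cmat_def hermitian_def entry_def by metis

lemma hermitian_cmat_power: "hermitian_cmat a \<Longrightarrow> hermitian_cmat (a ^ m)"
proof (induction m)
  case 0
  show ?case by (simp add: hermitian_cmat_iff entry_one)
next
  case (Suc m)
  then have "cnj (entry i j (a * a ^ m)) = entry j i (a ^ m * a)" for i j
    by (simp add: hermitian_cmat_iff entry_mult cnj_sum mult.commute)
  then show ?case
    unfolding hermitian_cmat_iff power_Suc power_commutes by blast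
qed

lemma hermitian_cmat_exp:
  assumes "hermitian_cmat a"
  shows "hermitian_cmat (exp a)"
  unfolding hermitian_cmat_iff
proof (intro allI)
  fix j i
  have sums: "(\<lambda>m. entry p q (a ^ m /\<^sub>R fact m)) sums entry p q (exp a)" for p q
    by (rule bounded_linear.sums[OF bounded_linear_entry exp_converges])
  have "(\<lambda>m. cnj (entry j i (a ^ m /\<^sub>R fact m))) sums cnj (entry j i (exp a))"
    by (rule bounded_linear.sums[OF bounded_linear_cnj sums])
  moreover have "cnj (entry j i (a ^ m /\<^sub>R fact m)) = entry i j (a ^ m /\<^sub>R fact m)" for m
    using hermitian_cmat_power[OF assms, of m]
    by (simp add: hermitian_cmat_iff entry_scaleR)
  ultimately show "cnj (entry j i (exp a)) = entry i j (exp a)"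
    using sums[of i j] by (simp add: sums_unique2)
qed

lemma hermitian_cmat_scaleR: "hermitian_cmat a \<Longrightarrow> hermitian_cmat (r *\<^sub>R a)"
  by (simp add: hermitian_cmat_iff entry_scaleR)

lemma hermitian_cmat_sum:
  "(\<And>x. x \<in> S \<Longrightarrow> hermitian_cmat (a x)) \<Longrightarrow> hermitian_cmat (\<Sum>x\<in>S. a x)"
  by (simp add: hermitian_cmat_iff entry_sum cnj_sum)

text \<open>The product need not be Hermitian, but conjugation only exchanges the two summation
  indices in the trace.\<close>

lemma ntrace_mult_hermitian_real:
  assumes "hermitian_cmat a" "hermitian_cmat b"
  shows "ntrace (a * b) \<in> \<real>"
proof -
  have "cnj (\<Sum>i\<in>UNIV. \<Sum>j\<in>UNIV. entry i j a * entry j i b)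
      = (\<Sum>i\<in>UNIV. \<Sum>j\<in>UNIV. entry j i a * entry i j b)"
    using assms by (simp add: hermitian_cmat_iff cnj_sum)
  also have "\<dots> = (\<Sum>i\<in>UNIV. \<Sum>j\<in>UNIV. entry i j a * entry j i b)"
    by (rule sum.swap)
  finally show ?thesis
    by (simp add: ntrace_conv_entry entry_mult Reals_cnj_iff)
qed

subsection \<open>Supports and expansion of ordered products\<close>

definition supp :: "'v::finite set \<Rightarrow> ('v \<Rightarrow> 'q::finite) cmat \<Rightarrow> bool"
  where "supp X a \<longleftrightarrow> supported_on X (matrix_of a)"

text \<open>Trades the existentially quantified coefficient function for invariance under a change
  of the common configuration off \<open>X\<close>, which can be checked on the entries
  directly.\<close>

lemma supp_iff:
  "supp X a \<longleftrightarrow>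
    (\<forall>s t. entry s t a \<noteq> 0 \<longrightarrow> (\<forall>v. v \<notin> X \<longrightarrow> s v = t v)) \<and>
    (\<forall>s t r. (\<forall>v. v \<notin> X \<longrightarrow> s v = t v) \<longrightarrow>
      entry (override_on r s X) (override_on r t X) a = entry s t a)" (is "_ \<longleftrightarrow> ?R")
proof
  assume "supp X a"
  then obtain c where c: "\<forall>s t s' t'. (\<forall>v\<in>X. s v = s' v \<and> t v = t' v) \<longrightarrow> c s t = c s' t'"
    and e: "\<forall>s t. entry s t a = (if \<forall>v. v \<notin> X \<longrightarrow> s v = t v then c s t else 0)"
    unfolding supp_def supported_on_def entry_def by (elim exE conjE)
  show ?R
  proof (intro conjI allI impI)
    fix s t v
    assume "entry s t a \<noteq> 0" "v \<notin> X"
    then show "s v = t v" using e by (metis (full_types))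
  next
    fix s t r :: "'a \<Rightarrow> 'b"
    assume "\<forall>v. v \<notin> X \<longrightarrow> s v = t v"
    moreover have "c (override_on r s X) (override_on r t X) = c s t"
      by (rule c[rule_format]) simp
    ultimately show "entry (override_on r s X) (override_on r t X) a = entry s t a"
      using e by simp
  qed
next
  assume R: ?R
  \<comment> \<open>A coefficient function is read off by freezing both configurations off
    \<open>X\<close> to one fixed background; \<open>undefined\<close> serves as that
    background.\<close>
  define c where "c = (\<lambda>s t. entry (override_on undefined s X) (override_on undefined t X) a)"
  have "c s t = c s' t'" if "\<forall>v\<in>X. s v = s' v \<and> t v = t' v" for s t s' t'
  proof -
    have "override_on undefined s X = override_on undefined s' X"
      "override_on undefined t X = override_on undefined t' X"
      using that by (auto simp: override_on_def)
    then show ?thesis by (simp add: c_def)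
  qed
  moreover have "matrix_of a $ s $ t = (if \<forall>v. v \<notin> X \<longrightarrow> s v = t v then c s t else 0)" for s t
    using R unfolding c_def entry_def by auto
  ultimately show "supp X a"
    unfolding supp_def supported_on_def by blast
qed

lemma supp_agree: "supp X a \<Longrightarrow> entry s t a \<noteq> 0 \<Longrightarrow> v \<notin> X \<Longrightarrow> s v = t v"
  unfolding supp_iff by blast

lemma supp_entry_cong:
  assumes "supp X a"
    and "\<And>v. v \<notin> X \<Longrightarrow> s v = t v" "\<And>v. v \<notin> X \<Longrightarrow> s' v = t' v"
    and "\<And>v. v \<in> X \<Longrightarrow> s v = s' v" "\<And>v. v \<in> X \<Longrightarrow> t v = t' v"
  shows "entry s t a = entry s' t' a"
proof -
  \<comment> \<open>On \<open>X\<close> the primed and unprimed configurations agree, and off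
    \<open>X\<close> the background \<open>s'\<close> coincides with \<open>t'\<close>.\<close>
  have "override_on s' s X = s'" "override_on s' t X = t'"
    using assms by (auto simp: override_on_def fun_eq_iff)
  moreover have "entry (override_on s' s X) (override_on s' t X) a = entry s t a"
    using assms(1,2) unfolding supp_iff by blast
  ultimately show ?thesis by simp
qed

lemma supp_mono:
  assumes "supp X a" "X \<subseteq> Y"
  shows "supp Y a"
  unfolding supp_iff
proof (intro conjI allI impI)
  fix s t v
  assume "entry s t a \<noteq> 0" "v \<notin> Y"
  then show "s v = t v" using assms by (meson subsetD supp_agree)
next
  fix s t r :: "'a \<Rightarrow> 'b"
  assume Y: "\<forall>v. v \<notin> Y \<longrightarrow> s v = t v"
  show "entry (override_on r s Y) (override_on r t Y) a = entry s t a"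
  proof (cases "\<forall>v. v \<notin> X \<longrightarrow> s v = t v")
    case True
    then show ?thesis
      using assms(2) by (intro supp_entry_cong[OF assms(1)]) (auto simp: override_on_def)
  next
    \<comment> \<open>The configurations differ at a site of \<open>Y\<close> outside
      \<open>X\<close>, where overriding on \<open>Y\<close> keeps them different, so both entries
      vanish.\<close>
    case False
    then obtain v where v: "v \<notin> X" "s v \<noteq> t v" by blast
    then have "override_on r s Y v \<noteq> override_on r t Y v"
      using Y by (auto simp: override_on_def)
    then show ?thesis using v supp_agree[OF assms(1)] by metis
  qed
qed

lemma supp_one: "supp X 1"
  unfolding supp_iff by (auto simp: entry_one fun_eq_iff override_on_def)

lemma supp_add: "supp X a \<Longrightarrow> supp X b \<Longrightarrow> supp X (a + b)"
  unfolding supp_iff by (auto simp: entry_add) (metis add_cancel_right_left)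

lemma supp_cscale: "supp X a \<Longrightarrow> supp X (cscale z a)"
  unfolding supp_iff by (auto simp: entry_cscale)

lemma supp_scaleR: "supp X a \<Longrightarrow> supp X (r *\<^sub>R a)"
  using supp_cscale[of X a "of_real r"] by (simp add: cscale_of_real)

text \<open>Only intermediate configurations that agree with \<open>s\<close> off \<open>X\<close>
  contribute to an entry of the product. Changing the background off \<open>X\<close> maps them
  bijectively to those that contribute to the overridden entry.\<close>

lemma supp_mult:
  assumes a: "supp X a" and b: "supp X b"
  shows "supp X (a * b)"
  unfolding supp_iff
proof (intro conjI allI impI)
  fix s t v
  assume "entry s t (a * b) \<noteq> 0" "v \<notin> X"
  then obtain u where "entry s u a * entry u t b \<noteq> 0"
    unfolding entry_mult by (meson sum.not_neutral_contains_not_neutral)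
  then show "s v = t v"
    using supp_agree[OF a, of s u v] supp_agree[OF b, of u t v] \<open>v \<notin> X\<close> by auto
next
  fix s t r :: "'a \<Rightarrow> 'b"
  assume st: "\<forall>v. v \<notin> X \<longrightarrow> s v = t v"
  let ?o = "\<lambda>s. override_on r s X"
  have restrict: "(\<Sum>u\<in>UNIV. entry s' u a * entry u t' b)
      = (\<Sum>u | \<forall>v. v \<notin> X \<longrightarrow> u v = s' v. entry s' u a * entry u t' b)" for s' t'
    using supp_agree[OF a, symmetric] by (intro sum.mono_neutral_right) auto
  have "(\<Sum>u | \<forall>v. v \<notin> X \<longrightarrow> u v = s v. entry s u a * entry u t b)
      = (\<Sum>u | \<forall>v. v \<notin> X \<longrightarrow> u v = ?o s v. entry (?o s) u a * entry u (?o t) b)"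
  proof (rule sum.reindex_bij_witness[where j = ?o and i = "\<lambda>u. override_on s u X"])
    fix u assume "u \<in> {u. \<forall>v. v \<notin> X \<longrightarrow> u v = s v}"
    then have u: "u v = s v" if "v \<notin> X" for v using that by auto
    then have "entry (?o s) (?o u) a = entry s u a" 
      by (intro supp_entry_cong[OF a]) (auto simp: override_on_def)
    moreover have "entry (?o u) (?o t) b = entry u t b" 
      using u st by (intro supp_entry_cong[OF b]) (auto simp: override_on_def)
    ultimately show "entry (?o s) (?o u) a * entry (?o u) (?o t) b = entry s u a * entry u t b"
      by simp
  qed (auto simp: override_on_def fun_eq_iff)
  then show "entry (?o s) (?o t) (a * b) = entry s t (a * b)"
    by (simp add: entry_mult restrict)
qed

text \<open>A single intermediate configuration survives: \<open>a\<close> forces it to equal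
  \<open>s\<close> off \<open>X\<close>, and \<open>b\<close> forces it to equal \<open>t\<close>
  off \<open>Y\<close>, in particular on \<open>X\<close>.\<close>

lemma entry_mult_disjoint_supp:
  assumes a: "supp X a" and b: "supp Y b" and disj: "X \<inter> Y = {}"
  shows "entry s t (a * b) =
    entry s (override_on s t X) a * entry (override_on s t X) t b"
proof -
  have "entry s u a * entry u t b = 0" if "u \<noteq> override_on s t X" for u
  proof (rule ccontr)
    assume "entry s u a * entry u t b \<noteq> 0"
    then have "entry s u a \<noteq> 0" "entry u t b \<noteq> 0" by auto
    then have "u = override_on s t X"
      using supp_agree[OF a, of s u] supp_agree[OF b, of u t] disj
      by (auto simp: override_on_def fun_eq_iff)
    with that show False by simp
  qed
  then show ?thesis
    unfolding entry_mult
    by (subst sum.mono_neutral_right[of _ "{override_on s t X}"]) auto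
qed

text \<open>Each order of the product has one surviving term, and the two terms agree because either
  factor sees only its own sites. If \<open>s\<close> and \<open>t\<close> differ outside both
  supports, both terms vanish.\<close>

lemma supp_disjoint_commute:
  fixes a b :: "('v::finite \<Rightarrow> 'q::finite) cmat"
  assumes a: "supp X a" and b: "supp Y b" and disj: "X \<inter> Y = {}"
  shows "a * b = b * a"
proof (rule cmat_eqI)
  fix s t :: "'v \<Rightarrow> 'q"
  let ?x = "override_on s t X" and ?y = "override_on s t Y"
  have ab: "entry s t (a * b) = entry s ?x a * entry ?x t b"
    by (rule entry_mult_disjoint_supp[OF a b disj])
  have ba: "entry s t (b * a) = entry s ?y b * entry ?y t a"
    by (rule entry_mult_disjoint_supp[OF b a]) (use disj in auto)
  show "entry s t (a * b) = entry s t (b * a)"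
  proof (cases "\<forall>v. v \<notin> X \<union> Y \<longrightarrow> s v = t v")
    case True
    have "entry s ?x a = entry ?y t a"
      using True disj by (intro supp_entry_cong[OF a]) (auto simp: override_on_def)
    moreover have "entry ?x t b = entry s ?y b"
      using True disj by (intro supp_entry_cong[OF b]) (auto simp: override_on_def)
    ultimately show ?thesis by (simp add: ab ba)
  next
    case False
    then obtain v where v: "v \<notin> X" "v \<notin> Y" "s v \<noteq> t v" by blast
    then have "entry ?x t b = 0" "entry ?y t a = 0"
      using supp_agree[OF b, of ?x t v] supp_agree[OF a, of ?y t v] by (auto simp: override_on_def)
    then show ?thesis by (simp add: ab ba)
  qed
qed

text \<open>The diagonal of \<open>a\<close> depends only on the part of a configuration on
  \<open>X\<close>, that of \<open>b\<close> only on the part on \<open>Y\<close>. Exchanging the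
  \<open>X\<close>-parts of a pair of configurations is an involution that turns the product of the
  two traces into a sum where both factors see the same configuration.\<close>

lemma ntrace_mult_disjoint_supp:
  fixes a b :: "('v::finite \<Rightarrow> 'q::finite) cmat"
  assumes a: "supp X a" and b: "supp Y b" and disj: "X \<inter> Y = {}"
  shows "ntrace (a * b) = ntrace a * ntrace b"
proof -
  let ?U = "UNIV :: ('v \<Rightarrow> 'q) set"
  have diag: "entry s s (a * b) = entry s s a * entry s s b" for s
    using entry_mult_disjoint_supp[OF a b disj, of s s] by (simp add: override_on_def)
  have "(\<Sum>s\<in>?U. entry s s a) * (\<Sum>r\<in>?U. entry r r b)
      = (\<Sum>(s, r)\<in>?U \<times> ?U. entry s s a * entry r r b)"
    by (simp add: sum_product sum.cartesian_product)
  also have "\<dots> = (\<Sum>(s, r)\<in>?U \<times> ?U. entry s s a * entry s s b)"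
  proof (rule sum.reindex_bij_witness[where
        i = "\<lambda>(s, r). (override_on r s X, override_on s r X)" and
        j = "\<lambda>(s, r). (override_on r s X, override_on s r X)"])
    fix p :: "('v \<Rightarrow> 'q) \<times> ('v \<Rightarrow> 'q)"
    obtain s r where p: "p = (s, r)" by fastforce
    let ?o = "override_on r s X"
    have "entry ?o ?o a = entry s s a"
      by (intro supp_entry_cong[OF a]) (auto simp: override_on_def)
    moreover have "entry ?o ?o b = entry r r b"
      using disj by (intro supp_entry_cong[OF b]) (auto simp: override_on_def)
    ultimately show "(case case p of (s, r) \<Rightarrow> (override_on r s X, override_on s r X) of
        (s, r) \<Rightarrow> entry s s a * entry s s b) = (case p of (s, r) \<Rightarrow> entry s s a * entry r r b)"
      by (simp add: p)
  qed (auto simp: override_on_def fun_eq_iff)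
  also have "\<dots> = of_nat CARD('v \<Rightarrow> 'q) * (\<Sum>s\<in>?U. entry s s a * entry s s b)"
    unfolding sum.cartesian_product[symmetric] by (simp add: sum_distrib_left)
  finally show ?thesis
    by (simp add: ntrace_conv_entry diag field_simps)
qed

section \<open>Ordered products and their expansion\<close>

lemma supp_prod_list: "(\<And>i. i \<in> set xs \<Longrightarrow> supp X (c i)) \<Longrightarrow> supp X (prod_list (map c xs))"
  by (induction xs) (auto intro: supp_one supp_mult)

text \<open>Disjoint supports commute, so each \<open>d i\<close> can be moved to the right past all
  later \<open>c\<close> factors without disturbing the order within either family.\<close>

lemma prod_list_mult_disjoint_supp:
  assumes "\<And>i. i \<in> set xs \<Longrightarrow> supp X (c i)" "\<And>i. i \<in> set xs \<Longrightarrow> supp Y (d i)" "X \<inter> Y = {}"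
  shows "prod_list (map (\<lambda>i. c i * d i) xs) = prod_list (map c xs) * prod_list (map d xs)"
  using assms(1,2)
proof (induction xs)
  case (Cons i xs)
  let ?c = "prod_list (map c xs)" and ?d = "prod_list (map d xs)"
  have comm: "d i * ?c = ?c * d i"
    using Cons.prems assms(3) by (intro supp_disjoint_commute[of Y _ X] supp_prod_list) auto
  have "prod_list (map (\<lambda>i. c i * d i) (i # xs)) = c i * (d i * ?c) * ?d"
    using Cons by (simp add: mult.assoc)
  then show ?case by (simp add: comm mult.assoc)
qed simp

lemma norm_prod_list_le:
  fixes c :: "'i \<Rightarrow> 'a::real_normed_algebra_1"
  shows "norm (prod_list (map c xs)) \<le> prod_list (map (\<lambda>i. norm (c i)) xs)"
  by (induction xs) (auto intro!: order_trans[OF norm_mult_ineq] mult_left_mono)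

text \<open>Double counting of the incidences of a site in \<open>X\<close> with a set
  \<open>Y i\<close>. It converts an overlap weight into site-by-site sums, which the locality
  hypothesis controls.\<close>

lemma sum_mult_card_Int:
  fixes w :: "'i \<Rightarrow> real"
  assumes "finite I" "finite X"
  shows "(\<Sum>i\<in>I. w i * card (Y i \<inter> X)) = (\<Sum>v\<in>X. \<Sum>i | i \<in> I \<and> v \<in> Y i. w i)"
proof -
  have "(\<Sum>i\<in>I. w i * card (Y i \<inter> X)) = (\<Sum>i\<in>I. \<Sum>v | v \<in> X \<and> v \<in> Y i. w i)"
    by (intro sum.cong refl) (simp add: Int_def conj_commute)
  also have "\<dots> = (\<Sum>v\<in>X. \<Sum>i | i \<in> I \<and> v \<in> Y i. w i)"
    using assms by (rule sum.swap_restrict)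
  finally show ?thesis .
qed

text \<open>The factors with index in \<open>I\<close> are still active; the others have been expanded to \<open>b i\<close>.\<close>
definition slot_prod :: "('i \<Rightarrow> 'a::ring_1) \<Rightarrow> 'i list \<Rightarrow> 'i set \<Rightarrow> ('i \<Rightarrow> 'a) \<Rightarrow> 'a"
  where "slot_prod a xs I b = prod_list (map (\<lambda>i. if i \<in> I then 1 + a i else b i) xs)"

text \<open>Distributivity at one position. Distinctness of the list ensures that updating
  \<open>b\<close> at \<open>i\<close> touches that position only.\<close>

lemma slot_prod_expand:
  assumes "distinct xs" "i \<in> set xs" "i \<in> I"
  shows "slot_prod a xs I b
    = slot_prod a xs (I - {i}) (b(i := 1)) + slot_prod a xs (I - {i}) (b(i := a i))"
proof -
  obtain ys zs where xs: "xs = ys @ i # zs" using assms(2) split_list by metis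
  then have i: "i \<notin> set ys" "i \<notin> set zs" using assms(1) by auto
  have map: "map (\<lambda>j. if j \<in> I - {i} then 1 + a j else (b(i := x)) j) us
      = map (\<lambda>j. if j \<in> I then 1 + a j else b j) us" if "i \<notin> set us" for us x
    using that by (intro map_cong) auto
  show ?thesis
    unfolding slot_prod_def xs map_append list.map map[OF i(1)] map[OF i(2)]
    using assms(3) by (simp add: algebra_simps)
qed

text \<open>In one expansion step the trace with the observable gains at most the factor 1 + 2x,
  while the reference trace loses at most the factor 1 - 2x. The exponential pays for the
  quotient.\<close>

lemma one_plus_le_exp_mult_one_minus:
  fixes x :: real
  assumes "0 \<le> x" "x \<le> 1 / 64"
  shows "1 + 2 * x \<le> exp (8 * x) * (1 - 2 * x)"
proof -
  have "x * x \<le> x * (1 / 64)" using assms by (intro mult_left_mono)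
  then have "1 + 2 * x \<le> (1 + 8 * x) * (1 - 2 * x)" using assms by (simp add: algebra_simps)
  also have "\<dots> \<le> exp (8 * x) * (1 - 2 * x)"
    using assms exp_ge_add_one_self[of "8 * x"] by (intro mult_right_mono) auto
  finally show ?thesis .
qed

text \<open>Induction on the set of active factors, for all regions \<open>S\<close> and fixed
  factors at once. When an active factor \<open>i\<close> meets \<open>S\<close>, the induction
  hypothesis is used three times: with region \<open>Y i\<close> to compare the reference trace
  before and after deleting factor \<open>i\<close>, and with \<open>S\<close> and
  \<open>S \<union> Y i\<close> for the two terms of the expansion.\<close>

lemma norm_ntrace_slot_prod_le:
  fixes a :: "'i \<Rightarrow> ('v::finite \<Rightarrow> 'q::finite) cmat" and Y :: "'i \<Rightarrow> 'v set"
  assumes xs: "distinct xs" "I0 \<subseteq> set xs"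
    and supp: "\<And>i. i \<in> I0 \<Longrightarrow> supp (Y i) (a i)"
    and card: "\<And>i. i \<in> I0 \<Longrightarrow> card (Y i) \<le> k"
    and local: "\<And>v. (\<Sum>i | i \<in> I0 \<and> v \<in> Y i. norm (a i)) \<le> \<eta>"
    and small: "k * \<eta> \<le> 1 / 64"
    and I: "I \<subseteq> I0" and b: "\<And>i. i \<in> set xs - I \<Longrightarrow> supp S (b i)"
  shows "norm (ntrace (slot_prod a xs I b))
    \<le> (\<Prod>i\<in>set xs - I. norm (b i)) * exp (8 * (\<Sum>i\<in>I. norm (a i) * card (Y i \<inter> S)))
      * norm (ntrace (slot_prod a xs I (\<lambda>_. 1)))"
proof -
  \<comment> \<open>The price of the overlap between a region and the active factors:
    submultiplicative in the region, and at most 2 for regions of at most \<open>k\<close> sites,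
    since 8 \<open>k\<close> \<open>\<eta>\<close> is at most 1/8.\<close>
  define E where "E = (\<lambda>S I. exp (8 * (\<Sum>i\<in>I. norm (a i) * card (Y i \<inter> S))))"
  have fin0: "finite I0" using xs(2) finite_subset by blast
  have \<eta>0: "0 \<le> \<eta>" using local[of undefined] by (rule order_trans[rotated]) (simp add: sum_nonneg)
  have E_ge_1: "1 \<le> E S I" for S I
    by (simp add: E_def sum_nonneg)
  have E_Un: "E (S \<union> T) I \<le> E S I * E T I" for S T I
  proof -
    have "card (Y i \<inter> (S \<union> T)) \<le> card (Y i \<inter> S) + card (Y i \<inter> T)" for i
      by (simp add: Int_Un_distrib card_Un_le)
    then have "(\<Sum>i\<in>I. norm (a i) * card (Y i \<inter> (S \<union> T)))
        \<le> (\<Sum>i\<in>I. norm (a i) * card (Y i \<inter> S) + norm (a i) * card (Y i \<inter> T))"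
      by (intro sum_mono) (simp add: mult_left_mono flip: distrib_left of_nat_add)
    then show ?thesis by (simp add: E_def sum.distrib flip: exp_add)
  qed
  have E_le_2: "E T I \<le> 2" if "I \<subseteq> I0" "card T \<le> k" for T I
  proof -
    have "(\<Sum>i\<in>I. norm (a i) * card (Y i \<inter> T)) \<le> (\<Sum>i\<in>I0. norm (a i) * card (Y i \<inter> T))"
      using that fin0 by (intro sum_mono2) auto
    also have "\<dots> = (\<Sum>v\<in>T. \<Sum>i | i \<in> I0 \<and> v \<in> Y i. norm (a i))"
      using fin0 by (intro sum_mult_card_Int) auto
    also have "\<dots> \<le> card T * \<eta>"
      using local by (intro sum_bounded_above) auto
    also have "\<dots> \<le> k * \<eta>" using that(2) \<eta>0 by (intro mult_right_mono) auto
    finally have "E T I \<le> exp (1 / 2)" unfolding E_def using small by simp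
    with exp_half_le2 show ?thesis by linarith
  qed
  have "finite I" using I fin0 finite_subset by blast
  then have "norm (ntrace (slot_prod a xs I b))
    \<le> (\<Prod>i\<in>set xs - I. norm (b i)) * E S I * norm (ntrace (slot_prod a xs I (\<lambda>_. 1)))"
    using I b
  proof (induction I arbitrary: b S rule: finite_psubset_induct)
    case (psubset I)
    show ?case
    proof (cases "\<exists>i\<in>I. Y i \<inter> S \<noteq> {}")
      case False
      \<comment> \<open>No active factor meets \<open>S\<close>, so the active and the fixed factors separate.\<close>
      define c where "c = (\<lambda>i. if i \<in> I then 1 else b i)"
      define d where "d = (\<lambda>i. if i \<in> I then 1 + a i else 1)"
      have c: "supp S (c i)" if "i \<in> set xs" for i
        using psubset.prems(2)[of i] that by (auto simp: c_def supp_one)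
      have d: "supp (- S) (d i)" for i
      proof (cases "i \<in> I")
        case True
        then have "Y i \<subseteq> - S" using False by auto
        then have "supp (- S) (a i)"
          using True psubset.prems(1) by (intro supp_mono[OF supp]) auto
        with True show ?thesis by (simp add: d_def supp_one supp_add)
      qed (simp add: d_def supp_one)
      have "slot_prod a xs I b = prod_list (map (\<lambda>i. c i * d i) xs)"
        unfolding slot_prod_def by (intro arg_cong[of _ _ prod_list] map_cong) (auto simp: c_def d_def)
      also have "\<dots> = prod_list (map c xs) * prod_list (map d xs)"
        using c d by (intro prod_list_mult_disjoint_supp[of _ S _ "- S"]) auto
      also have "prod_list (map d xs) = slot_prod a xs I (\<lambda>_. 1)"
        by (simp add: slot_prod_def d_def)
      finally have "ntrace (slot_prod a xs I b) = ntrace (prod_list (map c xs) * slot_prod a xs I (\<lambda>_. 1))"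
        by simp
      also have "\<dots> = ntrace (prod_list (map c xs)) * ntrace (slot_prod a xs I (\<lambda>_. 1))"
        using supp_prod_list[of xs S c] supp_prod_list[of xs "- S" d] c d
        by (intro ntrace_mult_disjoint_supp[of S _ "- S"]) (auto simp: slot_prod_def d_def)
      finally have eq: "norm (ntrace (slot_prod a xs I b))
          = norm (ntrace (prod_list (map c xs))) * norm (ntrace (slot_prod a xs I (\<lambda>_. 1)))"
        by (simp add: norm_mult)
      have "norm (ntrace (prod_list (map c xs))) \<le> prod_list (map (\<lambda>i. norm (c i)) xs)"
        by (rule order_trans[OF norm_ntrace_le norm_prod_list_le])
      also have "\<dots> = (\<Prod>i\<in>set xs. norm (c i))"
        using xs(1) by (simp add: prod.distinct_set_conv_list)
      also have "\<dots> = (\<Prod>i\<in>set xs - I. norm (b i))"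
        by (rule prod.mono_neutral_cong_right) (auto simp: c_def)
      also have "\<dots> \<le> (\<Prod>i\<in>set xs - I. norm (b i)) * E S I"
        using mult_left_mono[OF E_ge_1[of S I], of "\<Prod>i\<in>set xs - I. norm (b i)"]
        by (simp add: prod_nonneg)
      finally show ?thesis
        unfolding eq by (rule mult_right_mono) simp
    next
      case True
      then obtain i where i: "i \<in> I" "Y i \<inter> S \<noteq> {}" by blast
      define x where "x = norm (a i)"
      define J where "J = I - {i}"
      define B where "B = (\<Prod>j\<in>set xs - I. norm (b j))"
      define Z where "Z = norm (ntrace (slot_prod a xs J (\<lambda>_. 1)))"
      have i0: "i \<in> I0" "i \<in> set xs" and J: "J \<subset> I" "J \<subseteq> I0"
        using i(1) psubset.prems(1) xs(2) by (auto simp: J_def)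
      have diff: "set xs - J = insert i (set xs - I)" using i(1) i0(2) by (auto simp: J_def)
      have prod_upd: "(\<Prod>j\<in>set xs - J. norm ((b'(i := y)) j)) = norm y * (\<Prod>j\<in>set xs - I. norm (b' j))"
        for b' :: "'i \<Rightarrow> ('v \<Rightarrow> 'q) cmat" and y
        unfolding diff using i(1) by (subst prod.insert) (auto intro!: prod.cong)
      have IH: "norm (ntrace (slot_prod a xs J b')) \<le> (\<Prod>j\<in>set xs - J. norm (b' j)) * E T J * Z"
        if "\<And>j. j \<in> set xs - J \<Longrightarrow> supp T (b' j)" for b' T
        unfolding Z_def by (rule psubset.IH[OF J that])
      \<comment> \<open>\<open>Y i\<close> is nonempty, so \<open>k\<close> is at least 1 and a
        single norm is at most \<open>\<eta>\<close>, hence at most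
        \<open>k * \<eta>\<close>.\<close>
      have xk: "0 \<le> x" "x \<le> 1 / 64"
      proof -
        obtain v where v: "v \<in> Y i" using i by blast
        have "x \<le> (\<Sum>i | i \<in> I0 \<and> v \<in> Y i. norm (a i))"
          unfolding x_def using fin0 v i0 by (intro member_le_sum) auto
        then have "x \<le> \<eta>" using local[of v] by linarith
        moreover have "1 \<le> k"
          using card[OF i0(1)] v card_gt_0_iff[of "Y i"] by auto
        then have "\<eta> \<le> k * \<eta>" using \<eta>0 by (simp add: mult_le_cancel_right1)
        ultimately show "x \<le> 1 / 64" using small by linarith
      qed (simp add: x_def)
      have E2: "E (Y i) J \<le> 2" by (intro E_le_2 J(2) card i0)
      \<comment> \<open>Inserting \<open>a i\<close> alone into the reference product gives a trace
        of size at most 2 \<open>x\<close> \<open>Z\<close>, so restoring factor \<open>i\<close>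
        keeps at least the share 1 - 2 \<open>x\<close> of \<open>Z\<close>.\<close>
      have "norm (ntrace (slot_prod a xs J ((\<lambda>_. 1)(i := a i)))) \<le> x * E (Y i) J * Z"
        using IH[of "Y i" "(\<lambda>_. 1)(i := a i)"] supp[OF i0(1)] unfolding prod_upd
        by (auto simp: supp_one x_def)
      also have "\<dots> \<le> x * 2 * Z"
        using E2 xk by (intro mult_right_mono mult_left_mono) (auto simp: Z_def)
      finally have "norm (ntrace (slot_prod a xs I (\<lambda>_. 1))) \<ge> (1 - 2 * x) * Z"
        unfolding slot_prod_expand[OF xs(1) i0(2) i(1)] J_def[symmetric]
          linear_simps(1)[OF bounded_linear_ntrace]
        using norm_diff_ineq[of "ntrace (slot_prod a xs J (\<lambda>_. 1))"
            "ntrace (slot_prod a xs J ((\<lambda>_. 1)(i := a i)))"]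
        by (simp add: Z_def algebra_simps fun_upd_idem)
      then have lower: "(1 - 2 * x) * Z \<le> norm (ntrace (slot_prod a xs I (\<lambda>_. 1)))" .
      have "supp S ((b(i := 1)) j)" if "j \<in> set xs - J" for j
        using that psubset.prems(2)[of j] by (auto simp: diff supp_one)
      from IH[of S "b(i := 1)", OF this] have "norm (ntrace (slot_prod a xs J (b(i := 1)))) \<le> B * E S J * Z"
        unfolding prod_upd by (simp add: B_def)
      \<comment> \<open>Choosing \<open>a i\<close> costs its norm \<open>x\<close> and enlarges the
        region by \<open>Y i\<close>, whose extra overlap price is at most 2.\<close>
      moreover have "supp (S \<union> Y i) ((b(i := a i)) j)" if "j \<in> set xs - J" for j
        using that supp_mono[OF psubset.prems(2)[of j]] supp_mono[OF supp[OF i0(1)]] by (auto simp: diff)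
      from IH[of "S \<union> Y i" "b(i := a i)", OF this]
        have "norm (ntrace (slot_prod a xs J (b(i := a i)))) \<le> x * B * E (S \<union> Y i) J * Z"
        unfolding prod_upd by (simp add: B_def x_def)
      moreover have "x * B * E (S \<union> Y i) J * Z \<le> x * B * (E S J * 2) * Z"
        using E_Un[of S "Y i" J] E2 E_ge_1[of S J] xk
        by (intro mult_right_mono mult_left_mono)
          (auto simp: Z_def B_def prod_nonneg intro: order_trans mult_left_mono)
      ultimately have "norm (ntrace (slot_prod a xs I b)) \<le> B * E S J * Z + x * B * (E S J * 2) * Z"
        unfolding slot_prod_expand[OF xs(1) i0(2) i(1)] J_def[symmetric]
          linear_simps(1)[OF bounded_linear_ntrace]
        using norm_triangle_ineq[of "ntrace (slot_prod a xs J (b(i := 1)))"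
            "ntrace (slot_prod a xs J (b(i := a i)))"] by linarith
      also have "\<dots> = B * E S J * ((1 + 2 * x) * Z)" by (simp add: algebra_simps)
      also have "\<dots> \<le> B * E S J * (exp (8 * x) * (1 - 2 * x) * Z)"
        using one_plus_le_exp_mult_one_minus[OF xk] E_ge_1[of S J]
        by (intro mult_left_mono mult_right_mono) (auto simp: Z_def B_def prod_nonneg)
      also have "\<dots> = B * (E S J * exp (8 * x)) * ((1 - 2 * x) * Z)" by (simp add: mult_ac)
      also have "\<dots> \<le> B * E S I * ((1 - 2 * x) * Z)"
      proof (intro mult_right_mono mult_left_mono)
        have "(\<Sum>j\<in>I. norm (a j) * card (Y j \<inter> S))
            = x * card (Y i \<inter> S) + (\<Sum>j\<in>J. norm (a j) * card (Y j \<inter> S))"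
          unfolding x_def J_def using psubset.hyps(1) i(1) by (rule sum.remove)
        \<comment> \<open>\<open>Y i\<close> meets \<open>S\<close> in at least one site, so
          retiring \<open>i\<close> from the active set frees at least 8 \<open>x\<close> in the
          exponent, exactly what the quotient of gain and loss costs.\<close>
        moreover have "x * 1 \<le> x * card (Y i \<inter> S)"
          using i(2) xk card_gt_0_iff[of "Y i \<inter> S"] by (intro mult_left_mono) auto
        ultimately show "E S J * exp (8 * x) \<le> E S I" by (simp add: E_def flip: exp_add)
      qed (use xk in \<open>auto simp: Z_def B_def prod_nonneg\<close>)
      also have "\<dots> \<le> B * E S I * norm (ntrace (slot_prod a xs I (\<lambda>_. 1)))"
        using lower E_ge_1[of S I] by (intro mult_left_mono) (auto simp: B_def prod_nonneg)
      finally show ?thesis by (simp add: B_def)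
    qed
  qed
  then show ?thesis by (simp add: E_def)
qed

subsection \<open>Product formula and the locality estimate\<close>

text \<open>The factors are indexed by list positions, because the same local term may occur
  repeatedly. The observable occupies one additional slot \<open>None\<close>, which is never
  active, so the expansion starts from region \<open>X\<close>.\<close>

lemma norm_ntrace_mult_local_product_le:
  fixes ls :: "('v::finite set \<times> ('v \<Rightarrow> 'q::finite) cmat) list" and \<eta> :: real
  assumes supp: "\<And>Y a. (Y, a) \<in> set ls \<Longrightarrow> supp Y a"
    and card: "\<And>Y a. (Y, a) \<in> set ls \<Longrightarrow> card Y \<le> k"
    and local: "\<And>v. (\<Sum>(Y, a)\<leftarrow>ls. if v \<in> Y then norm a else 0) \<le> \<eta>"
    and small: "k * \<eta> \<le> 1 / 64"
    and A: "supp X A"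
  shows "norm (ntrace (A * (\<Prod>(Y, a)\<leftarrow>ls. 1 + a)))
    \<le> norm A * exp (8 * (card X * \<eta>)) * norm (ntrace (\<Prod>(Y, a)\<leftarrow>ls. 1 + a))"
proof -
  define n where "n = length ls"
  define xs where "xs = None # map Some [0..<n]"
  define I where "I = Some ` {..<n}"
  define Y where "Y = case_option {} (\<lambda>i. fst (ls ! i))"
  define a where "a = case_option 0 (\<lambda>i. snd (ls ! i))"
  define b where "b = (\<lambda>i :: nat option. if i = None then A else 1)"
  have nth: "(Y (Some i), a (Some i)) \<in> set ls" if "i < n" for i
    using that by (simp add: Y_def a_def n_def)
  have set_xs: "set xs = insert None I" by (auto simp: xs_def I_def)
  have slot: "slot_prod a xs I c = c None * (\<Prod>(Y, a)\<leftarrow>ls. 1 + a)" for c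
  proof -
    have "map (\<lambda>i. if i \<in> I then 1 + a i else c i) xs = c None # map (\<lambda>i. 1 + snd (ls ! i)) [0..<n]"
      by (auto simp: xs_def I_def a_def)
    also have "map (\<lambda>i. 1 + snd (ls ! i)) [0..<n] = map (\<lambda>(Y, a). 1 + a) ls"
      by (auto intro!: nth_equalityI simp: n_def split: prod.splits)
    finally show ?thesis by (simp add: slot_prod_def)
  qed
  have loc: "(\<Sum>i | i \<in> I \<and> v \<in> Y i. norm (a i)) \<le> \<eta>" for v
  proof -
    have "(\<Sum>i | i \<in> I \<and> v \<in> Y i. norm (a i)) = (\<Sum>i\<in>I. if v \<in> Y i then norm (a i) else 0)"
      by (simp add: I_def sum.inter_filter)
    also have "\<dots> = (\<Sum>i<n. if v \<in> fst (ls ! i) then norm (snd (ls ! i)) else 0)"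
      unfolding I_def by (subst sum.reindex) (auto simp: Y_def a_def cong: if_cong)
    also have "\<dots> = (\<Sum>(Y, a)\<leftarrow>ls. if v \<in> Y then norm a else 0)"
      by (simp add: sum_list_sum_nth n_def atLeast0LessThan split_def)
    finally show ?thesis using local[of v] by simp
  qed
  have "norm (ntrace (slot_prod a xs I b))
    \<le> (\<Prod>i\<in>set xs - I. norm (b i)) * exp (8 * (\<Sum>i\<in>I. norm (a i) * card (Y i \<inter> X)))
      * norm (ntrace (slot_prod a xs I (\<lambda>_. 1)))"
  proof (rule norm_ntrace_slot_prod_le[OF _ _ _ _ loc small order_refl])
    show "distinct xs" by (auto simp: xs_def distinct_map)
    show "I \<subseteq> set xs" using set_xs by auto
    show "supp (Y i) (a i)" "card (Y i) \<le> k" if "i \<in> I" for i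
      using that supp[OF nth] card[OF nth] by (auto simp: I_def)
    show "supp X (b i)" for i using A by (simp add: b_def supp_one)
  qed
  also have "(\<Sum>i\<in>I. norm (a i) * card (Y i \<inter> X)) = (\<Sum>v\<in>X. \<Sum>i | i \<in> I \<and> v \<in> Y i. norm (a i))"
    by (intro sum_mult_card_Int) (auto simp: I_def)
  also have "set xs - I = {None}" by (auto simp: set_xs I_def)
  finally have "norm (ntrace (A * (\<Prod>(Y, a)\<leftarrow>ls. 1 + a)))
      \<le> norm A * exp (8 * (\<Sum>v\<in>X. \<Sum>i | i \<in> I \<and> v \<in> Y i. norm (a i)))
        * norm (ntrace (\<Prod>(Y, a)\<leftarrow>ls. 1 + a))"
    by (simp add: slot b_def)
  also have "\<dots> \<le> norm A * exp (8 * (card X * \<eta>)) * norm (ntrace (\<Prod>(Y, a)\<leftarrow>ls. 1 + a))"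
    using loc by (intro mult_right_mono mult_left_mono) (auto intro!: sum_bounded_above)
  finally show ?thesis .
qed

section \<open>Product formula for exponentials\<close>

lemma norm_power_diff_le:
  fixes p q :: "'a::real_normed_algebra_1"
  assumes "norm p \<le> C" "norm q \<le> C" "1 \<le> C"
  shows "norm (p ^ n - q ^ n) \<le> n * C ^ n * norm (p - q)"
proof (induction n)
  case (Suc n)
  \<comment> \<open>Telescoping: one factor \<open>p\<close> is exchanged for \<open>q\<close> at a
    time.\<close>
  have "p ^ Suc n - q ^ Suc n = p * (p ^ n - q ^ n) + (p - q) * q ^ n"
    by (simp add: algebra_simps)
  then have "norm (p ^ Suc n - q ^ Suc n) \<le> norm p * norm (p ^ n - q ^ n) + norm (p - q) * norm (q ^ n)"
    by (metis (no_types, lifting) norm_triangle_le add_mono norm_mult_ineq)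
  also have "\<dots> \<le> C * (n * C ^ n * norm (p - q)) + norm (p - q) * (C * C ^ n)"
  proof (intro add_mono mult_mono)
    have "norm (q ^ n) \<le> C ^ n"
      by (rule order_trans[OF norm_power_ineq]) (simp add: power_mono assms)
    also have "\<dots> \<le> C * C ^ n" using assms by simp
    finally show "norm (q ^ n) \<le> C * C ^ n" .
  qed (use assms Suc.IH in auto)
  finally show ?case by (simp add: algebra_simps)
qed simp

lemma norm_prod_list_one_plus_le:
  fixes as :: "'a::real_normed_algebra_1 list"
  shows "norm (\<Prod>a\<leftarrow>as. 1 + a) \<le> exp (\<Sum>a\<leftarrow>as. norm a)"
proof (induction as)
  case (Cons a as)
  have "norm (1 + a) \<le> exp (norm a)"
    by (rule order_trans[OF norm_triangle_ineq]) simp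
  with Cons show ?case
    by (auto simp: exp_add intro!: order_trans[OF norm_mult_ineq] mult_mono)
qed simp

text \<open>At 0 every factor equals 1, so the order of the factors has no first-order
  effect.\<close>

lemma has_vector_derivative_prod_list_one_plus:
  fixes as :: "'a::real_normed_algebra_1 list"
  shows "((\<lambda>x::real. \<Prod>a\<leftarrow>as. 1 + x *\<^sub>R a) has_vector_derivative sum_list as) (at 0)"
proof (induction as)
  case (Cons a as)
  have "((\<lambda>x::real. 1 + x *\<^sub>R a) has_vector_derivative a) (at 0)"
    by (auto intro!: derivative_eq_intros)
  from has_vector_derivative_mult[OF this Cons] show ?case
    by (simp add: map_replicate_const add.commute)
qed simp

lemma exp_scaleR_power: "exp (a /\<^sub>R of_nat (Suc n)) ^ Suc n = exp a"
  for a :: "'a::{real_normed_algebra_1,banach}"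
proof -
  have "exp (of_nat m *\<^sub>R b) = exp b ^ m" for m and b :: 'a
  proof (induction m)
    case (Suc m)
    have "exp (of_nat (Suc m) *\<^sub>R b) = exp (b + of_nat m *\<^sub>R b)" by (simp add: algebra_simps)
    also have "\<dots> = exp b * exp (of_nat m *\<^sub>R b)" by (rule exp_add_commuting) simp
    finally show ?case using Suc by simp
  qed simp
  from this[of "Suc n" "a /\<^sub>R of_nat (Suc n)"] show ?thesis by simp
qed

text \<open>The Lie-Trotter formula for summands that need not commute, with each exponential factor
  replaced by its first-order truncation. The index \<open>Suc n\<close> keeps the step size defined
  for every \<open>n\<close>.\<close>

lemma exp_product_formula:
  fixes as :: "'a::{real_normed_algebra_1,banach} list"
  shows "(\<lambda>n. (\<Prod>a\<leftarrow>as. 1 + a /\<^sub>R of_nat (Suc n)) ^ Suc n) \<longlonglongrightarrow> exp (sum_list as)"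
proof -
  define \<sigma> where "\<sigma> = (\<Sum>a\<leftarrow>as. norm a)"
  define p where "p = (\<lambda>x::real. \<Prod>a\<leftarrow>as. 1 + x *\<^sub>R a)"
  define q where "q = (\<lambda>x::real. exp (x *\<^sub>R sum_list as))"
  have \<sigma>: "norm (sum_list as) \<le> \<sigma>" "0 \<le> \<sigma>"
    unfolding \<sigma>_def by (induction as) (auto intro: order_trans[OF norm_triangle_ineq])
  have p0: "p 0 = 1" "q 0 = 1" unfolding p_def q_def by (induction as) auto
  have bound: "norm (p x) \<le> exp (x * \<sigma>)" "norm (q x) \<le> exp (x * \<sigma>)" if "0 \<le> x" for x
  proof -
    have "(\<Sum>a\<leftarrow>map ((*\<^sub>R) x) as. norm a) = x * \<sigma>"
      using that unfolding \<sigma>_def by (induction as) (auto simp: algebra_simps)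
    with norm_prod_list_one_plus_le[of "map ((*\<^sub>R) x) as"] show "norm (p x) \<le> exp (x * \<sigma>)"
      by (simp add: p_def o_def)
    show "norm (q x) \<le> exp (x * \<sigma>)"
      unfolding q_def by (rule order_trans[OF norm_exp]) (use that \<sigma> in \<open>auto intro: mult_left_mono\<close>)
  qed
  \<comment> \<open>\<open>p\<close> and \<open>q\<close> agree to first order at \<open>0\<close>, so their \<open>n\<close>-th powers at \<open>1/n\<close> merge.\<close>
  have "((\<lambda>x. p x - q x) has_vector_derivative sum_list as - sum_list as) (at 0)"
    unfolding p_def q_def
    by (intro has_vector_derivative_diff has_vector_derivative_prod_list_one_plus)
      (use exp_scaleR_has_vector_derivative_left[of "sum_list as" 0] in simp)
  then have "((\<lambda>x. (p x - q x) /\<^sub>R \<bar>x\<bar>) \<longlongrightarrow> 0) (at 0)"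
    by (simp add: has_vector_derivative_def has_derivative_def p0)
  moreover have "norm ((p x - q x) /\<^sub>R x) = norm ((p x - q x) /\<^sub>R \<bar>x\<bar>)" for x
    unfolding norm_scaleR by simp
  ultimately have "((\<lambda>x. (p x - q x) /\<^sub>R x) \<longlongrightarrow> 0) (at 0)"
    by (intro tendsto_norm_zero_cancel[of "\<lambda>x. (p x - q x) /\<^sub>R x"]) (simp only: tendsto_norm_zero)
  moreover have "filterlim (\<lambda>n. inverse (real (Suc n))) (at 0) sequentially"
    by (intro filterlim_atI LIMSEQ_inverse_real_of_nat) auto
  ultimately have lim: "(\<lambda>n. (p (inverse (real (Suc n))) - q (inverse (real (Suc n)))) /\<^sub>R inverse (real (Suc n))) \<longlonglongrightarrow> 0"
    by (rule filterlim_compose)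
  have "(\<lambda>n. p (inverse (real (Suc n))) ^ Suc n - q (inverse (real (Suc n))) ^ Suc n) \<longlonglongrightarrow> 0"
  proof (rule Lim_null_comparison)
    show "\<forall>\<^sub>F n in sequentially. norm (p (inverse (real (Suc n))) ^ Suc n - q (inverse (real (Suc n))) ^ Suc n)
      \<le> exp \<sigma> * norm ((p (inverse (real (Suc n))) - q (inverse (real (Suc n)))) /\<^sub>R inverse (real (Suc n)))"
    proof (intro always_eventually allI)
      fix n
      let ?x = "inverse (real (Suc n))"
      have "norm (p ?x ^ Suc n - q ?x ^ Suc n) \<le> Suc n * exp (?x * \<sigma>) ^ Suc n * norm (p ?x - q ?x)"
        by (intro norm_power_diff_le bound) (auto simp: \<sigma>)
      \<comment> \<open>The power bound does not depend on \<open>n\<close>, and the remaining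
        factor \<open>Suc n\<close> turns the difference into a difference quotient at 0.\<close>
      also have "exp (?x * \<sigma>) ^ Suc n = exp \<sigma>"
        unfolding exp_of_nat_mult[symmetric] by simp
      finally show "norm (p ?x ^ Suc n - q ?x ^ Suc n) \<le> exp \<sigma> * norm ((p ?x - q ?x) /\<^sub>R ?x)"
        by (simp add: mult_ac)
    qed
    show "(\<lambda>n. exp \<sigma> * norm ((p (inverse (real (Suc n))) - q (inverse (real (Suc n)))) /\<^sub>R inverse (real (Suc n)))) \<longlonglongrightarrow> 0"
      using tendsto_mult_right_zero[OF tendsto_norm_zero[OF lim]] by simp
  qed
  moreover have "q (inverse (real (Suc n))) ^ Suc n = exp (sum_list as)" for n
    unfolding q_def by (rule exp_scaleR_power)
  ultimately show ?thesis
    unfolding p_def by (simp add: LIM_zero_iff del: power_Suc of_nat_Suc)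
qed

text \<open>Both exponentials are limits of ordered products of local factors. The finite estimate
  holds with constants independent of \<open>n\<close>, and both sides are continuous, so it
  survives the limit.\<close>

lemma norm_ntrace_mult_exp_exp_le:
  fixes f h :: "'v::finite set \<Rightarrow> ('v \<Rightarrow> 'q::finite) cmat" and \<eta> :: real
  assumes card: "\<And>Y. Y \<in> \<X> \<Longrightarrow> card Y \<le> k"
    and f: "\<And>Y. Y \<in> \<X> \<Longrightarrow> supp Y (f Y)" and h: "\<And>Y. Y \<in> \<X> \<Longrightarrow> supp Y (h Y)"
    and local: "\<And>v. (\<Sum>Y | Y \<in> \<X> \<and> v \<in> Y. norm (f Y) + norm (h Y)) \<le> \<eta>"
    and small: "k * \<eta> \<le> 1 / 64"
    and A: "supp X A"
  defines "W \<equiv> exp (\<Sum>Y\<in>\<X>. f Y) * exp (\<Sum>Y\<in>\<X>. h Y)"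
  shows "norm (ntrace (A * W)) \<le> norm A * exp (8 * (card X * \<eta>)) * norm (ntrace W)"
proof -
  obtain Ys where Ys: "set Ys = \<X>" "distinct Ys"
    using finite_distinct_list[of \<X>] by auto
  define P where "P = (\<lambda>(g :: 'v set \<Rightarrow> ('v \<Rightarrow> 'q) cmat) n. (\<Prod>Y\<leftarrow>Ys. 1 + g Y /\<^sub>R of_nat (Suc n)) ^ Suc n)"
  define L where "L = (\<lambda>(g :: 'v set \<Rightarrow> ('v \<Rightarrow> 'q) cmat) n.
    concat (replicate (Suc n) (map (\<lambda>Y. (Y, g Y /\<^sub>R of_nat (Suc n))) Ys)))"
  have lim: "P g \<longlonglongrightarrow> exp (\<Sum>Y\<in>\<X>. g Y)" for g
    using exp_product_formula[of "map g Ys"] Ys(2) unfolding Ys(1)[symmetric]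
    by (simp add: P_def o_def sum.distinct_set_conv_list del: power_Suc of_nat_Suc)
  have set_L: "set (L g n) = (\<lambda>Y. (Y, g Y /\<^sub>R of_nat (Suc n))) ` \<X>" for g n
    by (auto simp: L_def Ys(1)[symmetric])
  have prod_L: "(\<Prod>(Y, a)\<leftarrow>L g n. 1 + a) = P g n" for g n
  proof -
    have "(\<Prod>(Y, a)\<leftarrow>concat (replicate m (map (\<lambda>Y. (Y, g Y /\<^sub>R of_nat (Suc n))) Ys)). 1 + a)
        = (\<Prod>Y\<leftarrow>Ys. 1 + g Y /\<^sub>R of_nat (Suc n)) ^ m" for m
      by (induction m) (simp_all add: o_def)
    then show ?thesis by (simp only: L_def P_def)
  qed
  \<comment> \<open>Each term is repeated \<open>Suc n\<close> times at weight
    1/\<open>Suc n\<close>, so the local weight is the same for all \<open>n\<close> and one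
    \<open>\<eta>\<close> serves every approximant.\<close>
  have sum_L: "(\<Sum>(Y, a)\<leftarrow>L g n. if v \<in> Y then norm a else 0) = (\<Sum>Y | Y \<in> \<X> \<and> v \<in> Y. norm (g Y))" for g n v
  proof -
    have "(\<Sum>(Y, a)\<leftarrow>concat (replicate m (map (\<lambda>Y. (Y, g Y /\<^sub>R of_nat (Suc n))) Ys)). if v \<in> Y then norm a else 0)
        = m * (\<Sum>Y\<leftarrow>Ys. if v \<in> Y then norm (g Y) / of_nat (Suc n) else 0)" for m
      by (induction m) (simp_all add: o_def algebra_simps divide_inverse_commute cong: if_cong)
    then have "(\<Sum>(Y, a)\<leftarrow>L g n. if v \<in> Y then norm a else 0)
      = of_nat (Suc n) * (\<Sum>Y\<in>\<X>. if v \<in> Y then norm (g Y) / of_nat (Suc n) else 0)"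
      using Ys(2) unfolding Ys(1)[symmetric] by (simp only: L_def sum.distinct_set_conv_list)
    also have "\<dots> = (\<Sum>Y\<in>\<X>. if v \<in> Y then norm (g Y) else 0)"
      unfolding sum_distrib_left by (intro sum.cong) auto
    finally show ?thesis by (simp add: sum.inter_filter)
  qed
  have "norm (ntrace (A * (P f n * P h n))) \<le> norm A * exp (8 * (card X * \<eta>)) * norm (ntrace (P f n * P h n))" for n
  proof -
    have "(\<Sum>(Y, a)\<leftarrow>L f n @ L h n. if v \<in> Y then norm a else 0) \<le> \<eta>" for v
      using local[of v] by (simp add: sum_L sum.distrib)
    moreover have "supp Y a \<and> card Y \<le> k" if "(Y, a) \<in> set (L f n @ L h n)" for Y a
      using that f h card by (auto simp: set_L intro: supp_scaleR)
    ultimately show ?thesis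
      using norm_ntrace_mult_local_product_le[of "L f n @ L h n" k \<eta> X A] small A
      by (simp add: prod_L)
  qed
  moreover have W: "(\<lambda>n. P f n * P h n) \<longlonglongrightarrow> W"
    unfolding W_def by (intro tendsto_mult lim)
  have "(\<lambda>n. norm (ntrace (P f n * P h n))) \<longlonglongrightarrow> norm (ntrace W)"
    by (intro tendsto_norm bounded_linear.tendsto[OF bounded_linear_ntrace] W)
  from tendsto_mult_left[OF this] have "(\<lambda>n. norm A * exp (8 * (card X * \<eta>)) * norm (ntrace (P f n * P h n)))
      \<longlonglongrightarrow> norm A * exp (8 * (card X * \<eta>)) * norm (ntrace W)" .
  moreover have "(\<lambda>n. norm (ntrace (A * (P f n * P h n)))) \<longlonglongrightarrow> norm (ntrace (A * W))"
    by (intro tendsto_norm bounded_linear.tendsto[OF bounded_linear_ntrace] tendsto_mult_left W)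
  ultimately show ?thesis
    by (meson LIMSEQ_le)
qed

lemma ntrace_exp_exp_nonzero:
  fixes f h :: "'v::finite set \<Rightarrow> ('v \<Rightarrow> 'q::finite) cmat" and \<eta> :: real
  assumes "\<And>Y. Y \<in> \<X> \<Longrightarrow> card Y \<le> k"
    and "\<And>Y. Y \<in> \<X> \<Longrightarrow> supp Y (f Y)" and "\<And>Y. Y \<in> \<X> \<Longrightarrow> supp Y (h Y)"
    and "\<And>v. (\<Sum>Y | Y \<in> \<X> \<and> v \<in> Y. norm (f Y) + norm (h Y)) \<le> \<eta>"
    and "k * \<eta> \<le> 1 / 64"
  shows "ntrace (exp (\<Sum>Y\<in>\<X>. f Y) * exp (\<Sum>Y\<in>\<X>. h Y)) \<noteq> 0"
proof
  \<comment> \<open>Test the locality estimate with the inverse, viewed as supported on all sites.\<close>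
  let ?F = "\<Sum>Y\<in>\<X>. f Y" and ?H = "\<Sum>Y\<in>\<X>. h Y"
  assume "ntrace (exp ?F * exp ?H) = 0"
  moreover have "supp UNIV (exp (- ?H) * exp (- ?F))"
    by (simp add: supp_iff override_on_def)
  ultimately have "norm (ntrace (exp (- ?H) * exp (- ?F) * (exp ?F * exp ?H))) \<le> 0"
    using norm_ntrace_mult_exp_exp_le[OF assms] by force
  moreover have "exp (- ?H) * exp (- ?F) * (exp ?F * exp ?H) = exp (- ?H) * (exp (- ?F) * exp ?F) * exp ?H"
    by (simp add: mult.assoc)
  ultimately show False
    using exp_minus_inverse[of "- ?F"] exp_minus_inverse[of "- ?H"] by (simp add: ntrace_one)
qed

subsection \<open>Second-order bound for the logarithm\<close>

lemma real_restriction_has_derivative: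
  assumes "(f has_field_derivative f') (at (of_real s :: complex))"
  shows "((\<lambda>s. Re (f (of_real s))) has_real_derivative Re f') (at s)"
  using bounded_linear.has_vector_derivative[OF bounded_linear_Re has_vector_derivative_real_field[OF assms]]
  by (simp add: has_real_derivative_iff_has_vector_derivative)

text \<open>\<open>Z\<close> is real on the real axis, so by connectedness a loss of positivity
  would produce a zero in the disc, which \<open>nz\<close> excludes.\<close>

lemma real_restriction_pos:
  fixes Z :: "complex \<Rightarrow> complex"
  assumes "continuous_on UNIV Z"
    and nz: "\<And>z. norm z \<le> R \<Longrightarrow> Z z \<noteq> 0"
    and real: "\<And>s. Z (of_real s) \<in> \<real>"
    and pos: "0 < Re (Z 0)" and s: "\<bar>s\<bar> \<le> R"
  shows "0 < Re (Z (of_real s))"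
proof (rule ccontr)
  assume neg: "\<not> ?thesis"
  let ?\<phi> = "\<lambda>s. Re (Z (of_real s))"
  have "connected (?\<phi> ` {-R..R})"
    by (intro connected_continuous_image continuous_intros continuous_on_compose2[OF assms(1)]) auto
  moreover have "?\<phi> s \<in> ?\<phi> ` {-R..R}" "?\<phi> 0 \<in> ?\<phi> ` {-R..R}"
    using s by (force intro: image_eqI[where x = s] image_eqI[where x = 0])+
  ultimately have "0 \<in> ?\<phi> ` {-R..R}"
    by (rule connectedD_interval) (use neg pos in auto)
  then obtain t where "t \<in> {-R..R}" and t: "?\<phi> t = 0" by auto
  then have tR: "\<bar>t\<bar> \<le> R" by auto
  have "Z (of_real t) = 0"
    using t real[of t] by (auto simp: complex_eq_iff complex_is_Real_iff)
  with nz[of "of_real t"] tR show False by simp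
qed

text \<open>The holomorphic object is the logarithmic derivative \<open>\<psi>\<close>, so no branch
  of the complex logarithm has to be chosen; the real \<open>ln\<close> appears only on the real
  axis. The half in \<open>B / 2\<close> is the Taylor coefficient.\<close>

lemma ln_le_second_order:
  fixes Z Z' :: "complex \<Rightarrow> complex" and B R \<tau> :: real
  assumes der: "\<And>z. (Z has_field_derivative Z' z) (at z)"
    and nz: "\<And>z. norm z \<le> R \<Longrightarrow> Z z \<noteq> 0"
    and bound: "\<And>z. norm z \<le> R \<Longrightarrow> norm (Z' z) \<le> B * norm (Z z)"
    and real: "\<And>s. Z (of_real s) \<in> \<real>"
    and pos: "0 < Re (Z 0)" and \<tau>: "\<bar>\<tau>\<bar> < R"
  shows "ln (Re (Z (of_real \<tau>)))
    \<le> ln (Re (Z 0)) + \<tau> * (Re (Z' 0) / Re (Z 0)) + \<tau>\<^sup>2 * (B / 2) / (R - \<bar>\<tau>\<bar>)"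
proof -
  define \<psi> where "\<psi> = (\<lambda>z. Z' z / Z z)"
  \<comment> \<open>The successive derivatives of \<open>ln (Re Z)\<close> along the real axis, up
    to the second.\<close>
  define diff where "diff = (\<lambda>(m::nat) s. if m = 0 then ln (Re (Z (of_real s)))
    else if m = 1 then Re (\<psi> (of_real s)) else Re (deriv \<psi> (of_real s)))"
  have cont: "continuous_on UNIV Z"
    using der by (intro continuous_at_imp_continuous_on ballI) (rule DERIV_isCont)
  have Z_holo: "Z holomorphic_on UNIV"
    using der by (auto simp: holomorphic_on_def field_differentiable_def)
  have "deriv Z = Z'" using der DERIV_imp_deriv by blast
  with holomorphic_deriv[OF Z_holo] have Z'_holo: "Z' holomorphic_on UNIV" by simp
  have \<psi>_holo: "\<psi> holomorphic_on ball 0 R"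
    unfolding \<psi>_def using nz
    by (intro holomorphic_on_divide holomorphic_on_subset[OF Z'_holo] holomorphic_on_subset[OF Z_holo]) auto
  have \<psi>_cont: "continuous_on (cball 0 R) \<psi>"
    unfolding \<psi>_def using nz
    by (intro continuous_on_divide continuous_on_subset[OF cont]
        continuous_on_subset[OF holomorphic_on_imp_continuous_on[OF Z'_holo]]) auto
  have \<psi>_bound: "norm (\<psi> z) \<le> B" if "norm z \<le> R" for z
    using bound[OF that] nz[OF that] by (simp add: \<psi>_def norm_divide field_simps)
  \<comment> \<open>Discs of the common radius \<open>R - \<bar>\<tau>\<bar>\<close> around all
    these points lie in the disc of radius \<open>R\<close>, so one Cauchy bound covers the whole
    Taylor interval.\<close>
  have deriv_bound: "norm (deriv \<psi> (of_real s)) \<le> B / (R - \<bar>\<tau>\<bar>)" if s: "\<bar>s\<bar> \<le> \<bar>\<tau>\<bar>" for s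
  proof -
    let ?r = "R - \<bar>\<tau>\<bar>"
    have sub: "cball (complex_of_real s) ?r \<subseteq> cball 0 R" "ball (complex_of_real s) ?r \<subseteq> ball 0 R"
      using s by (simp_all add: cball_subset_cball_iff ball_subset_ball_iff dist_norm)
    have "norm ((deriv ^^ 1) \<psi> (of_real s)) \<le> fact 1 * B / ?r ^ 1"
    proof (rule Cauchy_inequality)
      show "\<psi> holomorphic_on ball (of_real s) ?r" by (rule holomorphic_on_subset[OF \<psi>_holo sub(2)])
      show "continuous_on (cball (of_real s) ?r) \<psi>" by (rule continuous_on_subset[OF \<psi>_cont sub(1)])
      show "0 < ?r" using \<tau> by simp
      show "norm (\<psi> x) \<le> B" if "norm (of_real s - x) = ?r" for x
        using \<psi>_bound[of x] sub(1) that by (auto simp: subset_iff dist_norm)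
    qed
    then show ?thesis by simp
  qed
  have real_eq: "Z (of_real s) = of_real (Re (Z (of_real s)))" for s
    using real[of s] by (simp add: complex_is_Real_iff complex_eq_iff)
  have "\<exists>t. \<bar>t\<bar> \<le> \<bar>\<tau>\<bar> \<and> ln (Re (Z (of_real \<tau>)))
      = (\<Sum>m<2. diff m 0 / fact m * \<tau> ^ m) + diff 2 t / fact 2 * \<tau> ^ 2"
  proof (rule Maclaurin_bi_le)
    show "diff 0 = (\<lambda>\<tau>. ln (Re (Z (of_real \<tau>))))" by (simp add: diff_def)
    show "\<forall>m t. m < 2 \<and> \<bar>t\<bar> \<le> \<bar>\<tau>\<bar> \<longrightarrow> DERIV (diff m) t :> diff (Suc m) t"
    proof (intro allI impI, elim conjE)
      fix m :: nat and t assume m: "m < 2" and t: "\<bar>t\<bar> \<le> \<bar>\<tau>\<bar>"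
      show "DERIV (diff m) t :> diff (Suc m) t"
      proof (cases "m = 0")
        case True
        \<comment> \<open>The denominator is real here, so the real part passes through the
          quotient.\<close>
        have "Re (\<psi> (of_real t)) = Re (Z' (of_real t)) / Re (Z (of_real t))"
          unfolding \<psi>_def by (subst real_eq) simp
        moreover have "((\<lambda>s. ln (Re (Z (of_real s)))) has_real_derivative
            1 / Re (Z (of_real t)) * Re (Z' (of_real t))) (at t)"
          using real_restriction_pos[OF cont nz real pos, of R t] t \<tau>
          by (intro DERIV_chain2[OF DERIV_ln_divide] real_restriction_has_derivative der) auto
        ultimately show ?thesis by (simp add: diff_def True)
      next
        case False
        then have "m = 1" using m by simp
        moreover have "(\<psi> has_field_derivative deriv \<psi> (of_real t)) (at (of_real t))"
          using t \<tau> by (intro holomorphic_derivI[OF \<psi>_holo]) auto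
        then have "((\<lambda>s. Re (\<psi> (of_real s))) has_real_derivative Re (deriv \<psi> (of_real t))) (at t)"
          by (rule real_restriction_has_derivative)
        ultimately show ?thesis by (simp add: diff_def)
      qed
    qed
  qed
  then obtain t where t: "\<bar>t\<bar> \<le> \<bar>\<tau>\<bar>" and eq: "ln (Re (Z (of_real \<tau>)))
      = ln (Re (Z 0)) + Re (\<psi> 0) * \<tau> + Re (deriv \<psi> (of_real t)) / 2 * \<tau>\<^sup>2"
    by (auto simp: diff_def numeral_2_eq_2)
  have "Re (deriv \<psi> (of_real t)) \<le> B / (R - \<bar>\<tau>\<bar>)"
    using complex_Re_le_cmod deriv_bound[OF t] order_trans by blast
  then have "Re (deriv \<psi> (of_real t)) / 2 * \<tau>\<^sup>2 \<le> B / (R - \<bar>\<tau>\<bar>) / 2 * \<tau>\<^sup>2"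
    by (intro mult_right_mono divide_right_mono) auto
  moreover have "Re (\<psi> 0) = Re (Z' 0) / Re (Z 0)"
    using real_eq[of 0] unfolding \<psi>_def by (metis Re_divide_of_real of_real_0)
  ultimately show ?thesis by (simp add: eq mult.commute)
qed

text \<open>\<open>cmat\<close> carries no complex structure, so complex differentiability is
  obtained from a scalar power series in \<open>z\<close> that converges everywhere and is
  differentiated term by term.\<close>

lemma has_field_derivative_ntrace_exp:
  fixes A E :: "'n::finite cmat"
  shows "((\<lambda>z. ntrace (exp (cscale z A) * E)) has_field_derivative
    ntrace (A * exp (cscale z A) * E)) (at z)"
proof -
  define c where "c = (\<lambda>m. ntrace (A ^ m * E) / fact m)"
  have pow: "cscale z A ^ m /\<^sub>R fact m = cscale (z ^ m / fact m) (A ^ m)" for z m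
    by (rule cmat_eqI) (simp add: entry_scaleR entry_cscale cscale_power field_simps)
  have mult: "B * cscale w D * E = cscale w (B * D * E)" for B D w
    by (rule cmat_eqI) (simp add: entry_mult entry_cscale sum_distrib_left sum_distrib_right mult_ac)
  have sums: "(\<lambda>m. z ^ m / fact m * ntrace (B * A ^ m * E)) sums ntrace (B * exp (cscale z A) * E)" for B z
  proof -
    have "bounded_linear (\<lambda>x. ntrace (B * x * E))"
      by (intro bounded_linear_compose[OF bounded_linear_ntrace]
          bounded_linear_mult_const bounded_linear_const_mult bounded_linear_ident)
    from bounded_linear.sums[OF this exp_converges, of "cscale z A"] show ?thesis
      by (simp add: pow mult ntrace_cscale)
  qed
  have c_sums: "(\<lambda>m. c m * z ^ m) sums ntrace (exp (cscale z A) * E)" for z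
    using sums[of z 1] by (simp add: c_def mult_ac)
  \<comment> \<open>The shift of the index turns (m+1)/(m+1)! into 1/m! and splits off one factor
    \<open>A\<close>.\<close>
  have "diffs c m = ntrace (A * A ^ m * E) / fact m" for m
    by (simp add: diffs_def c_def mult.assoc del: of_nat_Suc)
  then have d_sums: "(\<lambda>m. diffs c m * z ^ m) sums ntrace (A * exp (cscale z A) * E)"
    using sums[of z A] by (simp add: mult_ac)
  have "((\<lambda>z. \<Sum>m. c m * z ^ m) has_field_derivative (\<Sum>m. diffs c m * z ^ m)) (at z)"
    using c_sums by (intro termdiffs_strong_converges_everywhere) (rule sums_summable)
  then show ?thesis
    using sums_unique[OF c_sums] sums_unique[OF d_sums] by simp
qed

section \<open>Gibbs traces of two local interactions\<close>

definition local_interaction ::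
    "nat \<Rightarrow> real \<Rightarrow> ('v::finite set \<Rightarrow> ('v \<Rightarrow> 'q::finite) cmat) \<Rightarrow> bool"
  where "local_interaction k g f \<longleftrightarrow>
    (\<forall>X. card X \<le> k \<longrightarrow> supp X (f X) \<and> hermitian_cmat (f X)) \<and>
    (\<forall>v. (\<Sum>X | card X \<le> k \<and> v \<in> X. norm (f X)) \<le> g)"

definition interaction_sum ::
    "nat \<Rightarrow> ('v::finite set \<Rightarrow> ('v \<Rightarrow> 'q::finite) cmat) \<Rightarrow> ('v \<Rightarrow> 'q) cmat"
  where "interaction_sum k f = (\<Sum>X | card X \<le> k. f X)"

context
  fixes k :: nat and g \<beta> R :: real and f h :: "'v::finite set \<Rightarrow> ('v \<Rightarrow> 'q::finite) cmat"
  assumes f: "local_interaction k g f" and h: "local_interaction k g h"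
    and \<beta>: "0 \<le> \<beta>" and small: "k * ((R + \<beta>) * g) \<le> 1 / 64"
begin

text \<open>The unnormalised Gibbs operator perturbed by a complex field \<open>z\<close>. The two
  interaction sums need not commute, so the exponentials stay separate.\<close>

definition gibbs :: "complex \<Rightarrow> ('v \<Rightarrow> 'q) cmat"
  where "gibbs z = exp (cscale z (- interaction_sum k f)) * exp ((- \<beta>) *\<^sub>R interaction_sum k h)"

text \<open>For \<open>z\<close> in the disc, the terms of both exponents together have weight at
  most \<open>(R + \<beta>) * g\<close> at each site, which is what \<open>small\<close> is made
  for. Linearity then sums the locality estimate over the terms of the perturbation.\<close>

lemma
  assumes z: "norm z \<le> R"
  shows ntrace_gibbs_nonzero: "ntrace (gibbs z) \<noteq> 0"
    and norm_ntrace_mult_gibbs_le: "norm (ntrace (- interaction_sum k f * gibbs z)) \<le> 2 * (\<Sum>X | card X \<le> k. norm (f X)) * norm (ntrace (gibbs z))"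
proof -
  note [simp] = interaction_sum_def
  let ?f = "\<lambda>X. cscale z (- f X)" and ?h = "\<lambda>X. (- \<beta>) *\<^sub>R h X" and ?\<eta> = "(R + \<beta>) * g"
  have g0: "0 \<le> g"
    using f unfolding local_interaction_def by (meson norm_ge_zero order_trans sum_nonneg)
  have R0: "0 \<le> R" using z norm_ge_zero order_trans by blast
  have sums: "cscale z (- interaction_sum k f) = (\<Sum>X | card X \<le> k. ?f X)" "(- \<beta>) *\<^sub>R interaction_sum k h = (\<Sum>X | card X \<le> k. ?h X)"
    by (simp_all add: cscale_def sum_distrib_left sum_negf scaleR_sum_right)
  have supp: "supp X (?f X)" "supp X (?h X)" if "X \<in> {X. card X \<le> k}" for X
  proof -
    have "?f X = cscale (- z) (f X)"
      by (rule cmat_eqI) (simp add: entry_cscale bounded_linear.linear[OF bounded_linear_entry, THEN linear_neg])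
    with that show "supp X (?f X)"
      using f unfolding local_interaction_def by (auto intro: supp_cscale)
    show "supp X (?h X)"
      using that h unfolding local_interaction_def by (intro supp_scaleR) auto
  qed
  have local: "(\<Sum>X | X \<in> {X. card X \<le> k} \<and> v \<in> X. norm (?f X) + norm (?h X)) \<le> ?\<eta>" for v
  proof -
    have "(\<Sum>X | card X \<le> k \<and> v \<in> X. norm (?f X) + norm (?h X))
        \<le> (\<Sum>X | card X \<le> k \<and> v \<in> X. norm z * norm (f X) + \<beta> * norm (h X))"
      using norm_cscale_le[of z "- f _"] \<beta> by (intro sum_mono add_mono) auto
    also have "\<dots> = norm z * (\<Sum>X | card X \<le> k \<and> v \<in> X. norm (f X)) + \<beta> * (\<Sum>X | card X \<le> k \<and> v \<in> X. norm (h X))"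
      by (simp add: sum.distrib sum_distrib_left)
    also have "\<dots> \<le> R * g + \<beta> * g"
      using f h z \<beta> R0 unfolding local_interaction_def
      by (intro add_mono mult_mono) (auto intro: sum_nonneg)
    finally show ?thesis by (simp add: algebra_simps)
  qed
  have card: "card Y \<le> k" if "Y \<in> {X. card X \<le> k}" for Y using that by simp
  show "ntrace (gibbs z) \<noteq> 0"
    unfolding gibbs_def sums by (rule ntrace_exp_exp_nonzero[OF card supp local small])
  have term_le: "norm (ntrace (- f X * gibbs z)) \<le> 2 * norm (f X) * norm (ntrace (gibbs z))" if X: "card X \<le> k" for X
  proof -
    have "supp X (- f X)"
      using f X supp_scaleR[of X "f X" "- 1"] by (auto simp: local_interaction_def)
    then have "norm (ntrace (- f X * gibbs z)) \<le> norm (- f X) * exp (8 * (card X * ?\<eta>)) * norm (ntrace (gibbs z))"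
      unfolding gibbs_def sums by (intro norm_ntrace_mult_exp_exp_le[OF card supp local small])
    \<comment> \<open>A term has at most \<open>k\<close> sites, so the exponent is at most 8/64;
      this yields the factor 2.\<close>
    also have "exp (8 * (card X * ?\<eta>)) \<le> exp (1 / 2)"
      using mult_right_mono[of "real (card X)" "real k" ?\<eta>] X small R0 \<beta> g0 by simp
    also have "exp (1 / 2) \<le> (2 :: real)" by (rule exp_half_le2)
    finally show ?thesis by (simp add: mult_ac mult_left_mono mult_right_mono)
  qed
  have "ntrace (- interaction_sum k f * gibbs z) = (\<Sum>X | card X \<le> k. ntrace (- f X * gibbs z))"
    by (simp add: sum_distrib_right sum_negf bounded_linear.linear[OF bounded_linear_ntrace, THEN linear_sum]
       flip: sum_negf)
  also have "norm \<dots> \<le> (\<Sum>X | card X \<le> k. 2 * norm (f X) * norm (ntrace (gibbs z)))"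
    by (intro sum_norm_le term_le) simp
  finally show "norm (ntrace (- interaction_sum k f * gibbs z)) \<le> 2 * (\<Sum>X | card X \<le> k. norm (f X)) * norm (ntrace (gibbs z))"
    by (simp add: sum_distrib_left sum_distrib_right)
qed

lemma ntrace_gibbs_real: "ntrace (gibbs (of_real s)) \<in> \<real>"
proof -
  have "hermitian_cmat (interaction_sum k f)" "hermitian_cmat (interaction_sum k h)"
    using f h unfolding local_interaction_def interaction_sum_def by (auto intro: hermitian_cmat_sum)
  then have "hermitian_cmat (exp ((- s) *\<^sub>R interaction_sum k f))" "hermitian_cmat (exp ((- \<beta>) *\<^sub>R interaction_sum k h))"
    by (auto intro!: hermitian_cmat_exp hermitian_cmat_scaleR simp del: scaleR_minus_left)
  then show ?thesis
    by (simp add: gibbs_def cscale_of_real ntrace_mult_hermitian_real)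
qed

lemma gibbs_has_field_derivative:
  "((\<lambda>z. ntrace (gibbs z)) has_field_derivative ntrace (- interaction_sum k f * gibbs z)) (at z)"
  using has_field_derivative_ntrace_exp[of "- interaction_sum k f"] by (simp add: gibbs_def mult.assoc)

text \<open>Positivity propagates from field 0 along the real axis because the trace is real there
  and has no zero; no spectral theory enters.\<close>

lemma ntrace_gibbs_pos:
  assumes "0 < Re (ntrace (exp ((- \<beta>) *\<^sub>R interaction_sum k h)))" "\<bar>s\<bar> \<le> R"
  shows "0 < Re (ntrace (exp ((- s) *\<^sub>R interaction_sum k f) * exp ((- \<beta>) *\<^sub>R interaction_sum k h)))"
proof -
  have "continuous_on UNIV (\<lambda>z. ntrace (gibbs z))"
    using gibbs_has_field_derivative
    by (intro continuous_at_imp_continuous_on ballI) (rule DERIV_isCont)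
  from real_restriction_pos[OF this ntrace_gibbs_nonzero ntrace_gibbs_real _ assms(2)] assms(1)
  show ?thesis by (simp add: gibbs_def cscale_of_real cscale_zero)
qed

text \<open>The logarithmic derivative is bounded by twice the total norm of the interaction, and
  the Taylor half cancels the 2.\<close>

lemma ln_ntrace_gibbs_le:
  assumes pos: "0 < Re (ntrace (exp ((- \<beta>) *\<^sub>R interaction_sum k h)))" and \<tau>: "\<bar>\<tau>\<bar> < R"
  shows "ln (Re (ntrace (exp ((- \<tau>) *\<^sub>R interaction_sum k f) * exp ((- \<beta>) *\<^sub>R interaction_sum k h))))
    \<le> ln (Re (ntrace (exp ((- \<beta>) *\<^sub>R interaction_sum k h))))
      - \<tau> * (Re (ntrace (interaction_sum k f * exp ((- \<beta>) *\<^sub>R interaction_sum k h))) / Re (ntrace (exp ((- \<beta>) *\<^sub>R interaction_sum k h))))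
      + \<tau>\<^sup>2 * (\<Sum>X | card X \<le> k. norm (f X)) / (R - \<bar>\<tau>\<bar>)"
  using ln_le_second_order[OF gibbs_has_field_derivative ntrace_gibbs_nonzero
      norm_ntrace_mult_gibbs_le ntrace_gibbs_real _ \<tau>] pos
  by (simp add: gibbs_def cscale_of_real cscale_zero bounded_linear.linear[OF bounded_linear_ntrace, THEN linear_neg])

end

section \<open>Critical temperature and transfer to plain matrices\<close>

theorem theorem1:
  fixes h f :: "'v::finite set \<Rightarrow> ('v, 'q::finite) op"
    and k :: nat and g \<beta> \<tau> :: real
  assumes k_pos: "k \<ge> 1" and g_pos: "g > 0"
    and h_herm: "\<And>X. card X \<le> k \<Longrightarrow> hermitian (h X)"
    and h_supp: "\<And>X. card X \<le> k \<Longrightarrow> supported_on X (h X)"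
    and h_local: "\<And>v. (\<Sum>X\<in>{X. card X \<le> k \<and> v \<in> X}. op_norm (h X)) \<le> g"
    and f_herm: "\<And>X. card X \<le> k \<Longrightarrow> hermitian (f X)"
    and f_supp: "\<And>X. card X \<le> k \<Longrightarrow> supported_on X (f X)"
    and f_local: "\<And>v. (\<Sum>X\<in>{X. card X \<le> k \<and> v \<in> X}. op_norm (f X)) \<le> g"
    and beta_nonneg: "\<beta> \<ge> 0"
    and beta_small: "\<beta> < 1 / (8 * exp 3 * g * k)"
    and tau_small: "\<bar>\<tau>\<bar> < 1 / (8 * exp 3 * g * k) - \<beta>"
  shows
    "let H = (\<Sum>X\<in>{X. card X \<le> k}. h X);
         F = (\<Sum>X\<in>{X. card X \<le> k}. f X);
         Fbar = (\<Sum>X\<in>{X. card X \<le> k}. op_norm (f X));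
         Z = Re (trace (mat_exp ((- \<beta>) *\<^sub>R H)));
         \<rho> = (1 / Z) *\<^sub>R mat_exp ((- \<beta>) *\<^sub>R H);
         expF = Re (trace (F ** \<rho>));
         \<beta>c = 1 / (8 * exp 3 * g * k)
     in ln (Re (trace (mat_exp ((- \<tau>) *\<^sub>R F) ** \<rho>)))
          \<le> - \<tau> * expF + \<tau>\<^sup>2 * Fbar / (\<beta>c - \<beta> - \<bar>\<tau>\<bar>)"
proof -
  define f' where "f' X = Cmat (f X)" for X
  define h' where "h' X = Cmat (h X)" for X
  define F where "F = interaction_sum k f'"
  define H where "H = interaction_sum k h'"
  define \<beta>c where "\<beta>c = 1 / (8 * exp 3 * g * k)"
  define E where "E = exp ((- \<beta>) *\<^sub>R H)"
  define D where "D = real CARD('v \<Rightarrow> 'q)"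
  have loc: "local_interaction k g f'" "local_interaction k g h'"
    using h_herm h_supp h_local f_herm f_supp f_local
    by (simp_all add: local_interaction_def f'_def h'_def supp_def hermitian_cmat_def
        norm_cmat.rep_eq Cmat_inverse)
  have zero: "local_interaction k g (\<lambda>_. 0 :: ('v \<Rightarrow> 'q) cmat)"
    using g_pos supp_scaleR[OF supp_one, of _ 0] hermitian_cmat_sum[of "{}" undefined]
    by (auto simp: local_interaction_def)
  \<comment> \<open>\<open>k * (\<beta>c * g)\<close> equals 1/(8 \<open>exp 3\<close>), so this
    bound gives the required 1/64.\<close>
  have "(8::real) \<le> exp 3"
  proof -
    have "(2::real) ^ 3 \<le> exp 1 ^ 3" using exp_ge_add_one_self[of 1] by (intro power_mono) auto
    also have "\<dots> = exp 3" by (simp flip: exp_of_nat_mult)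
    finally show ?thesis by simp
  qed
  then have small: "k * (\<beta>c * g) \<le> 1 / 64"
    using g_pos k_pos by (simp add: \<beta>c_def field_simps)
  \<comment> \<open>Positivity of the partition function: \<open>H\<close> in the role of \<open>F\<close>, at inverse temperature \<open>0\<close>.\<close>
  have "0 < Re (ntrace (exp ((- \<beta>) *\<^sub>R interaction_sum k h') * exp ((- 0) *\<^sub>R interaction_sum k (\<lambda>_. 0 :: ('v \<Rightarrow> 'q) cmat))))"
    by (rule ntrace_gibbs_pos[where R = \<beta>c and g = g, OF loc(2) zero])
      (use small beta_small beta_nonneg in \<open>auto simp: ntrace_one \<beta>c_def\<close>)
  then have E_pos: "0 < Re (ntrace E)" by (simp add: E_def H_def)
  \<comment> \<open>The disc has radius \<open>R = \<beta>c - \<beta>\<close>, so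
    \<open>R + \<beta>\<close> is \<open>\<beta>c\<close>.\<close>
  have small': "k * ((\<beta>c - \<beta> + \<beta>) * g) \<le> 1 / 64" using small by simp
  have \<tau>: "\<bar>\<tau>\<bar> < \<beta>c - \<beta>" using tau_small by (simp add: \<beta>c_def)
  note E = E_def[unfolded H_def]
  \<comment> \<open>Positivity of numerator and denominator lets the logarithm of their quotient
    split into a difference.\<close>
  have num_pos: "0 < Re (ntrace (exp ((- \<tau>) *\<^sub>R F) * E))"
    unfolding F_def E by (rule ntrace_gibbs_pos[OF loc beta_nonneg small' E_pos[unfolded E]]) (use \<tau> in simp)
  have main: "ln (Re (ntrace (exp ((- \<tau>) *\<^sub>R F) * E)))
      \<le> ln (Re (ntrace E)) - \<tau> * (Re (ntrace (F * E)) / Re (ntrace E))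
        + \<tau>\<^sup>2 * (\<Sum>X | card X \<le> k. norm (f' X)) / (\<beta>c - \<beta> - \<bar>\<tau>\<bar>)"
    unfolding F_def E by (rule ln_ntrace_gibbs_le[OF loc beta_nonneg small' E_pos[unfolded E] \<tau>])
  have D_pos: "0 < D" by (simp add: D_def)
  have F: "(\<Sum>X | card X \<le> k. f X) = matrix_of F" and H: "(\<Sum>X | card X \<le> k. h X) = matrix_of H"
    by (simp_all add: F_def H_def interaction_sum_def matrix_of_sum f'_def h'_def Cmat_inverse)
  have exps: "mat_exp ((- \<beta>) *\<^sub>R matrix_of H) = matrix_of E"
    "mat_exp ((- \<tau>) *\<^sub>R matrix_of F) = matrix_of (exp ((- \<tau>) *\<^sub>R F))"
    by (simp_all only: E_def matrix_of_exp scaleR_cmat.rep_eq)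
  \<comment> \<open>The dimension \<open>D\<close> in the trace cancels against the one in the
    normalisation of the state, leaving a quotient of normalised traces.\<close>
  have tr: "Re (trace (matrix_of a ** ((1 / (D * Re (ntrace E))) *\<^sub>R matrix_of E)))
      = Re (ntrace (a * E)) / Re (ntrace E)" for a
  proof -
    have "matrix_of a ** ((1 / (D * Re (ntrace E))) *\<^sub>R matrix_of E)
        = matrix_of ((1 / (D * Re (ntrace E))) *\<^sub>R (a * E))"
      by (simp only: times_cmat.rep_eq[symmetric] scaleR_cmat.rep_eq[symmetric] mult_scaleR_right)
    then have "trace (matrix_of a ** ((1 / (D * Re (ntrace E))) *\<^sub>R matrix_of E))
        = D * ((1 / (D * Re (ntrace E))) *\<^sub>R ntrace (a * E))"
      by (simp add: trace_matrix_of D_def linear_simps(5)[OF bounded_linear_ntrace])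
    then show ?thesis using D_pos by simp
  qed
  have norms: "(\<Sum>X | card X \<le> k. op_norm (f X)) = (\<Sum>X | card X \<le> k. norm (f' X))"
    by (simp add: f'_def norm_cmat.rep_eq Cmat_inverse)
  have Z: "Re (trace (matrix_of E)) = D * Re (ntrace E)"
    by (simp add: trace_matrix_of D_def)
  have "ln (Re (ntrace (exp ((- \<tau>) *\<^sub>R F) * E)) / Re (ntrace E))
      \<le> - \<tau> * (Re (ntrace (F * E)) / Re (ntrace E))
        + \<tau>\<^sup>2 * (\<Sum>X | card X \<le> k. norm (f' X)) / (\<beta>c - \<beta> - \<bar>\<tau>\<bar>)"
    using main num_pos E_pos by (simp add: ln_div)
  then show ?thesis
    unfolding Let_def F H exps Z tr norms \<beta>c_def .
qed

end
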